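(* Let $\mathsf{TDFSKL}$ be any TDF-SKL with domain sampler, with domain $\{0,1\}^{n(\lambda)}$ for a polynomial $n$. Then the PKE-SKL scheme $\mathsf{PKESKL}=(\mathsf{KG},\mathsf{Enc},\mathsf{Dec},\mathsf{Del},\mathsf{Vrfy})$ with message space $\{0,1\}$ built from $\mathsf{TDFSKL}$ by the construction given in the context is IND-VRA secure.
   Context: Conventions. $\lambda$ is the security parameter; PPT means classical probabilistic polynomial time and QPT quantum polynomial time; adversaries are non-uniform QPT. $\mathrm{negl}$ denotes an unspecified negligible function. Key generation algorithms with quantum output sample tuples consisting of classical strings and a quantum state, and probabilities over keys are over this sampling. $x\leftarrow S$ for a finite set $S$ means uniform sampling. $x\cdot r$ is the inner product of bit strings modulo 2. TDF-SKL with domain sampler (domain $\{0,1\}^{n(\lambda)}$). A tuple $(\mathsf{TDF.KG},\mathsf{TDF.Samp},\mathsf{TDF.Eval},\mathsf{TDF.Inv},\mathsf{TDF.Del},\mathsf{TDF.Vrfy})$ of efficient algorithms: QPT $\mathsf{TDF.KG}(1^\lambda)\to(\mathsf{ek},\mathsf{td},\mathsf{vk})$ with $\mathsf{ek},\mathsf{vk}$ classical and $\mathsf{td}$ a quantum state; PPT $\mathsf{TDF.Samp}(\mathsf{ek})\to x\in\{0,1\}^{n(\lambda)}$; classical deterministic $\mathsf{TDF.Eval}(\mathsf{ek},x)\to y$; QPT $\mathsf{TDF.Inv}(\mathsf{td},y)\to(x',\mathsf{td}')$; QPT $\mathsf{TDF.Del}(\mathsf{td})\to\mathsf{cert}$ (classical);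 deterministic $\mathsf{TDF.Vrfy}(\mathsf{vk},\mathsf{cert})\to\top/\bot$. Requirements: - Almost-all-keys inversion correctness: with probability $\ge1-\mathrm{negl}(\lambda)$ over the keys, for all $x\in\{0,1\}^{n(\lambda)}$, $\mathsf{TDF.Inv}(\mathsf{td},\mathsf{TDF.Eval}(\mathsf{ek},x))$ outputs $x$ with probability $\ge1-\mathrm{negl}(\lambda)$. - Deletion verification correctness: $\Pr[\mathsf{TDF.Vrfy}(\mathsf{vk},\mathsf{TDF.Del}(\mathsf{td}))=\top]\ge1-\mathrm{negl}(\lambda)$. - OW-VRA security: every QPT $A$ wins the following game with probability at most $\mathrm{negl}(\lambda)$: the challenger samples $(\mathsf{ek},\mathsf{td},\mathsf{vk})\leftarrow\mathsf{TDF.KG}(1^\lambda)$ and sends $(\mathsf{ek},\mathsf{td})$ to $A$; $A$ sends $\mathsf{cert}$; if $\mathsf{TDF.Vrfy}(\mathsf{vk},\mathsf{cert})=\bot$, $A$ loses; otherwise the challenger samples $x\leftarrow\mathsf{TDF.Samp}(\mathsf{ek})$ and sends $(\mathsf{TDF.Eval}(\mathsf{ek},x),\mathsf{vk})$; $A$ sends $x'$ and wins iff $x'=x$. Construction of $\mathsf{PKESKL}$. - $\mathsf{KG}(1^\lambda)$: run $(\mathsf{ek}_T,\mathsf{td}_T,\mathsf{vk}_T)\leftarrow\mathsf{TDF.KG}(1^\lambda)$; return $\mathsf{ek}=\mathsf{ek}_T$, $\mathsf{dk}=(\mathsf{ek}_T,\mathsf{td}_T)$, $\mathsf{vk}=\mathsf{vk}_T$.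 - $\mathsf{Enc}(\mathsf{ek},\mu)$, $\mu\in\{0,1\}$: sample $r\leftarrow\{0,1\}^{n(\lambda)}$, $x\leftarrow\mathsf{TDF.Samp}(\mathsf{ek}_T)$; set $y=\mathsf{TDF.Eval}(\mathsf{ek}_T,x)$, $b=(x\cdot r)\oplus\mu$; return $\mathsf{ct}=(y,r,b)$. - $\mathsf{Dec}(\mathsf{dk},\mathsf{ct})$: (1) if $\mathsf{ct}$ does not parse as $(y,r,b)$ with $r\in\{0,1\}^{n(\lambda)}$, $b\in\{0,1\}$, output $(\bot,\mathsf{dk})$. (2) Coherently (unitarily) run $\mathsf{TDF.Inv}(\mathsf{td}_T,y)$ to obtain a preimage register $x'$, and compute in a result register $(x'\cdot r)\oplus b$ if $\mathsf{TDF.Eval}(\mathsf{ek}_T,x')=y$ and $\bot$ otherwise. (3) Copy the result register (in the computational basis) into an ancilla register and uncompute step (2). (4) Measure the ancilla to obtain $\mu'$; let $\mathsf{td}_T'$ be the resulting state of the trapdoor register; output $(\mu',(\mathsf{ek}_T,\mathsf{td}_T'))$. - $\mathsf{Del}(\mathsf{dk})=\mathsf{TDF.Del}(\mathsf{td}_T)$; $\mathsf{Vrfy}(\mathsf{vk},\mathsf{cert})=\mathsf{TDF.Vrfy}(\mathsf{vk}_T,\mathsf{cert})$. IND-VRA security. For $b\in\{0,1\}$ consider the experiment $\mathsf{Exp}(\lambda,b)$ with adversary $A$: (1) the challenger samples $(\mathsf{ek},\mathsf{dk},\mathsf{vk})\leftarrow\mathsf{KG}(1^\lambda)$ and sends $(\mathsf{ek},\mathsf{dk})$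 to $A$; (2) $A$ sends $\mathsf{cert}$ and two messages $(\mu_0,\mu_1)$; if $\mathsf{Vrfy}(\mathsf{vk},\mathsf{cert})=\bot$ the experiment outputs $0$; otherwise $A$ receives $(\mathsf{ct},\mathsf{vk})$ with $\mathsf{ct}\leftarrow\mathsf{Enc}(\mathsf{ek},\mu_b)$; (3) $A$ outputs a bit $b'$, which is the output of the experiment. IND-VRA security: for every QPT $A$, $|\Pr[1\leftarrow\mathsf{Exp}(\lambda,0)]-\Pr[1\leftarrow\mathsf{Exp}(\lambda,1)]|\le\mathrm{negl}(\lambda)$. *)

theory Defs
  imports
    "HOL-Library.Landau_Symbols"
    "HOL-Probability.Probability_Mass_Function"
    "HOL-Analysis.Complex_Transcendental"
begin

section \<open>Asymptotics and bit strings\<close>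

definition poly_bounded :: "(nat \<Rightarrow> nat) \<Rightarrow> bool" where
  "poly_bounded f \<longleftrightarrow> (\<exists>k. (\<lambda>l. real (f l)) \<in> O(\<lambda>l. real l ^ k))"

definition negligible :: "(nat \<Rightarrow> real) \<Rightarrow> bool" where
  "negligible f \<longleftrightarrow> (\<forall>k. f \<in> O(\<lambda>l. 1 / real l ^ k))"

definition bits :: "nat \<Rightarrow> bool list set" where
  "bits n = {w. length w = n}"

abbreviation zeros :: "nat \<Rightarrow> bool list" where
  "zeros n \<equiv> replicate n False"

text \<open>Inner product modulo 2 of two strings of equal length.  The exclusive or of two bits is
  written \<open>a \<noteq> b\<close> throughout.\<close>

definition ip2 :: "bool list \<Rightarrow> bool list \<Rightarrow> bool" where
  "ip2 x r \<longleftrightarrow> odd (card {i. i < length x \<and> x ! i \<and> r ! i})"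


section \<open>Polynomial-time Turing machines\<close>

text \<open>Deterministic one-tape machines, used only to express uniformity of circuit families.  A
  program is a finite table from (state, scanned symbol) to (new state, written symbol, move); the
  machine halts when no entry applies.  Symbol 0 is the blank, 1 and 2 stand for the two bits, and
  further symbols may be used freely as work symbols.\<close>

datatype direction = MoveLeft | Stay | MoveRight

type_synonym tm = "((nat \<times> nat) \<times> (nat \<times> nat \<times> direction)) list"
type_synonym tm_config = "nat \<times> int \<times> (int \<Rightarrow> nat)"

fun move :: "direction \<Rightarrow> int \<Rightarrow> int" where
  "move MoveLeft h = h - 1"
| "move Stay h = h"
| "move MoveRight h = h + 1"

fun tm_step :: "tm \<Rightarrow> tm_config \<Rightarrow> tm_config" where
  "tm_step M (q, h, t) =
     (case map_of M (q, t h) of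
        None \<Rightarrow> (q, h, t)
      | Some (q', a, d) \<Rightarrow> (q', move d h, t(h := a)))"

fun tm_halted :: "tm \<Rightarrow> tm_config \<Rightarrow> bool" where
  "tm_halted M (q, h, t) \<longleftrightarrow> map_of M (q, t h) = None"

definition tm_symbol :: "bool \<Rightarrow> nat" where
  "tm_symbol b = (if b then 2 else 1)"

definition tm_init :: "bool list \<Rightarrow> tm_config" where
  "tm_init w = (0, 0, \<lambda>i. if 0 \<le> i \<and> i < int (length w) then tm_symbol (w ! nat i) else 0)"

fun tm_output :: "tm_config \<Rightarrow> bool list \<Rightarrow> bool" where
  "tm_output (q, h, t) v \<longleftrightarrow>
     (\<forall>i<length v. t (int i) = tm_symbol (v ! i)) \<and> t (int (length v)) = 0"

definition poly_time_unary :: "(nat \<Rightarrow> bool list) \<Rightarrow> bool" where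
  "poly_time_unary f \<longleftrightarrow>
     (\<exists>M p. poly_bounded p \<and>
        (\<forall>l. \<exists>s\<le>p l. let c = (tm_step M ^^ s) (tm_init (replicate l True))
                     in tm_halted M c \<and> tm_output c (f l)))"


section \<open>Circuits\<close>

datatype cgate = NOT nat | CNOT nat nat | CCNOT nat nat nat

datatype gate = Classical cgate | H nat | T nat | Tdg nat

fun cgate_wires :: "cgate \<Rightarrow> nat list" where
  "cgate_wires (NOT i) = [i]"
| "cgate_wires (CNOT i j) = [i, j]"
| "cgate_wires (CCNOT i j k) = [i, j, k]"

fun gate_wires :: "gate \<Rightarrow> nat list" where
  "gate_wires (Classical g) = cgate_wires g"
| "gate_wires (H i) = [i]"
| "gate_wires (T i) = [i]"
| "gate_wires (Tdg i) = [i]"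

text \<open>The last wire is the target.\<close>

fun apply_cgate :: "cgate \<Rightarrow> bool list \<Rightarrow> bool list" where
  "apply_cgate (NOT i) w = w[i := (\<not> w ! i)]"
| "apply_cgate (CNOT i j) w = w[j := (w ! j \<noteq> w ! i)]"
| "apply_cgate (CCNOT i j k) w = w[k := (w ! k \<noteq> (w ! i \<and> w ! j))]"

text \<open>Pure states of \<open>m\<close> qubits are given by their amplitudes on the strings of length \<open>m\<close>, and
  operators by their matrix entries in the computational basis.  Entries at strings of another
  length are never used.\<close>

type_synonym ket = "bool list \<Rightarrow> complex"
type_synonym qop = "bool list \<Rightarrow> bool list \<Rightarrow> complex"

definition basis_ket :: "bool list \<Rightarrow> ket" where
  "basis_ket v = (\<lambda>w. if w = v then 1 else 0)"

text \<open>Classical gates on distinct wires are involutions on strings, so the amplitude at \<open>w\<close> after the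
  gate is the amplitude at the image of \<open>w\<close> before it.\<close>

fun apply_gate :: "gate \<Rightarrow> ket \<Rightarrow> ket" where
  "apply_gate (Classical g) \<psi> = (\<lambda>w. \<psi> (apply_cgate g w))"
| "apply_gate (H i) \<psi> =
     (\<lambda>w. (\<psi> (w[i := False]) + (if w ! i then - 1 else 1) * \<psi> (w[i := True]))
            / complex_of_real (sqrt 2))"
| "apply_gate (T i) \<psi> = (\<lambda>w. (if w ! i then cis (pi / 4) else 1) * \<psi> w)"
| "apply_gate (Tdg i) \<psi> = (\<lambda>w. (if w ! i then cis (- pi / 4) else 1) * \<psi> w)"

fun inverse_gate :: "gate \<Rightarrow> gate" where
  "inverse_gate (Classical g) = Classical g"
| "inverse_gate (H i) = H i"
| "inverse_gate (T i) = Tdg i"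
| "inverse_gate (Tdg i) = T i"

definition apply_gates :: "gate list \<Rightarrow> ket \<Rightarrow> ket" where
  "apply_gates gs = fold apply_gate gs"

definition inverse_gates :: "gate list \<Rightarrow> gate list" where
  "inverse_gates gs = rev (map inverse_gate gs)"

text \<open>A quantum circuit acts on \<open>q_wires\<close> qubits.  Initially these hold, in this order, a classical
  input of \<open>q_cin\<close> bits, a quantum input of \<open>q_qin\<close> qubits, and zeros.  After the gates, the first
  \<open>q_cout\<close> wires are measured, the next \<open>q_qout\<close> wires are the quantum output, and the rest is
  discarded.\<close>

record qcircuit =
  q_cin :: nat
  q_qin :: nat
  q_cout :: nat
  q_qout :: nat
  q_wires :: nat
  q_gates :: "gate list"

definition wf_qcircuit :: "qcircuit \<Rightarrow> bool" where
  "wf_qcircuit C \<longleftrightarrow>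
     q_cin C + q_qin C \<le> q_wires C \<and> q_cout C + q_qout C \<le> q_wires C \<and>
     (\<forall>g\<in>set (q_gates C). distinct (gate_wires g) \<and> set (gate_wires g) \<subseteq> {..<q_wires C})"

text \<open>A classical circuit takes an input of \<open>c_in\<close> bits, \<open>c_coins\<close> random bits, and zeros, and
  outputs its first \<open>c_out\<close> wires; it is deterministic when \<open>c_coins = 0\<close>.\<close>

record ccircuit =
  c_in :: nat
  c_coins :: nat
  c_out :: nat
  c_wires :: nat
  c_gates :: "cgate list"

definition wf_ccircuit :: "ccircuit \<Rightarrow> bool" where
  "wf_ccircuit C \<longleftrightarrow>
     c_in C + c_coins C \<le> c_wires C \<and> c_out C \<le> c_wires C \<and>
     (\<forall>g\<in>set (c_gates C). distinct (cgate_wires g) \<and> set (cgate_wires g) \<subseteq> {..<c_wires C})"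

definition crun :: "ccircuit \<Rightarrow> bool list \<Rightarrow> bool list \<Rightarrow> bool list" where
  "crun C s coins =
     take (c_out C) (fold apply_cgate (c_gates C)
       (s @ coins @ zeros (c_wires C - length s - length coins)))"

definition csample :: "ccircuit \<Rightarrow> bool list \<Rightarrow> bool list pmf" where
  "csample C s = map_pmf (crun C s) (pmf_of_set (bits (c_coins C)))"

text \<open>Operators returned by a measurement are not normalised: for a classical outcome \<open>z\<close> the
  operator below is the conditional state multiplied by the probability of \<open>z\<close>, so its trace is that
  probability.  Here \<open>U\<close> is the unitary, \<open>init u\<close> the initial basis string when the quantum input
  of \<open>q\<close> qubits is the basis state \<open>u\<close>, and \<open>fin z u g\<close> the final basis string with measured part
  \<open>z\<close>, quantum output \<open>u\<close> and discarded part \<open>g\<close> of \<open>d\<close> qubits.\<close>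

definition measure_op ::
    "(ket \<Rightarrow> ket) \<Rightarrow> nat \<Rightarrow> (bool list \<Rightarrow> bool list) \<Rightarrow>
     nat \<Rightarrow> (bool list \<Rightarrow> bool list \<Rightarrow> bool list \<Rightarrow> bool list) \<Rightarrow>
     qop \<Rightarrow> bool list \<Rightarrow> qop" where
  "measure_op U q init d fin \<rho> z = (\<lambda>u v.
     \<Sum>g\<in>bits d. \<Sum>u'\<in>bits q. \<Sum>v'\<in>bits q.
       U (basis_ket (init u')) (fin z u g) * \<rho> u' v' * cnj (U (basis_ket (init v')) (fin z v g)))"

definition qrun :: "qcircuit \<Rightarrow> bool list \<Rightarrow> qop \<Rightarrow> bool list \<Rightarrow> qop" where
  "qrun C s =
     measure_op (apply_gates (q_gates C)) (q_qin C)
       (\<lambda>u. s @ u @ zeros (q_wires C - q_cin C - q_qin C))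
       (q_wires C - q_cout C - q_qout C)
       (\<lambda>z u g. z @ u @ g)"

definition qtrace :: "nat \<Rightarrow> qop \<Rightarrow> real" where
  "qtrace q \<rho> = Re (\<Sum>u\<in>bits q. \<rho> u u)"

definition qprob :: "qcircuit \<Rightarrow> bool list \<Rightarrow> qop \<Rightarrow> bool list \<Rightarrow> real" where
  "qprob C s \<rho> z = qtrace (q_qout C) (qrun C s \<rho> z)"

text \<open>The state of the empty register.\<close>

definition no_qubits :: qop where
  "no_qubits = (\<lambda>_ _. 1)"


section \<open>Efficient algorithms\<close>

fun cgate_code :: "cgate \<Rightarrow> nat list" where
  "cgate_code (NOT i) = [0, i]"
| "cgate_code (CNOT i j) = [1, i, j]"
| "cgate_code (CCNOT i j k) = [2, i, j, k]"

fun gate_code :: "gate \<Rightarrow> nat list" where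
  "gate_code (Classical g) = cgate_code g"
| "gate_code (H i) = [3, i]"
| "gate_code (T i) = [4, i]"
| "gate_code (Tdg i) = [5, i]"

definition encode_nats :: "nat list \<Rightarrow> bool list" where
  "encode_nats ns = concat (map (\<lambda>n. replicate n True @ [False]) ns)"

definition encode_qcircuit :: "qcircuit \<Rightarrow> bool list" where
  "encode_qcircuit C =
     encode_nats ([q_cin C, q_qin C, q_cout C, q_qout C, q_wires C]
                  @ concat (map gate_code (q_gates C)))"

definition encode_ccircuit :: "ccircuit \<Rightarrow> bool list" where
  "encode_ccircuit C =
     encode_nats ([c_in C, c_coins C, c_out C, c_wires C]
                  @ concat (map cgate_code (c_gates C)))"

text \<open>Adversaries are arbitrary circuit families of polynomial size; the algorithms of a scheme are
  families that can moreover be written down in polynomial time from the security parameter in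
  unary.\<close>

definition nonuniform_QPT :: "(nat \<Rightarrow> qcircuit) \<Rightarrow> bool" where
  "nonuniform_QPT C \<longleftrightarrow>
     (\<forall>l. wf_qcircuit (C l)) \<and>
     poly_bounded (\<lambda>l. q_wires (C l)) \<and> poly_bounded (\<lambda>l. length (q_gates (C l)))"

definition QPT :: "(nat \<Rightarrow> qcircuit) \<Rightarrow> bool" where
  "QPT C \<longleftrightarrow> nonuniform_QPT C \<and> poly_time_unary (\<lambda>l. encode_qcircuit (C l))"

definition PPT :: "(nat \<Rightarrow> ccircuit) \<Rightarrow> bool" where
  "PPT C \<longleftrightarrow>
     (\<forall>l. wf_ccircuit (C l)) \<and>
     poly_bounded (\<lambda>l. c_wires (C l)) \<and> poly_bounded (\<lambda>l. length (c_gates (C l))) \<and>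
     poly_time_unary (\<lambda>l. encode_ccircuit (C l))"

definition has_qtype :: "qcircuit \<Rightarrow> nat \<Rightarrow> nat \<Rightarrow> nat \<Rightarrow> nat \<Rightarrow> bool" where
  "has_qtype C ci qi co qo \<longleftrightarrow> q_cin C = ci \<and> q_qin C = qi \<and> q_cout C = co \<and> q_qout C = qo"

definition has_ctype :: "ccircuit \<Rightarrow> nat \<Rightarrow> nat \<Rightarrow> bool" where
  "has_ctype C i out \<longleftrightarrow> c_in C = i \<and> c_out C = out"


section \<open>TDF-SKL with domain sampler\<close>

text \<open>For each security parameter, keys, images and certificates are strings of fixed length and the
  trapdoor is a register of a fixed number of qubits.  \<open>TDF_KG\<close> outputs the classical string
  \<open>ek @ vk\<close> together with the trapdoor register.\<close>

record tdf_skl =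
  n_dom :: "nat \<Rightarrow> nat"
  len_ek :: "nat \<Rightarrow> nat"
  len_vk :: "nat \<Rightarrow> nat"
  len_td :: "nat \<Rightarrow> nat"
  len_y :: "nat \<Rightarrow> nat"
  len_cert :: "nat \<Rightarrow> nat"
  TDF_KG :: "nat \<Rightarrow> qcircuit"
  TDF_Samp :: "nat \<Rightarrow> ccircuit"
  TDF_Eval :: "nat \<Rightarrow> ccircuit"
  TDF_Inv :: "nat \<Rightarrow> qcircuit"
  TDF_Del :: "nat \<Rightarrow> qcircuit"
  TDF_Vrfy :: "nat \<Rightarrow> ccircuit"

definition tdf_kg :: "tdf_skl \<Rightarrow> nat \<Rightarrow> bool list \<Rightarrow> bool list \<Rightarrow> qop" where
  "tdf_kg S l ek vk = qrun (TDF_KG S l) [] no_qubits (ek @ vk)"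

definition tdf_samp :: "tdf_skl \<Rightarrow> nat \<Rightarrow> bool list \<Rightarrow> bool list pmf" where
  "tdf_samp S l ek = csample (TDF_Samp S l) ek"

definition tdf_eval :: "tdf_skl \<Rightarrow> nat \<Rightarrow> bool list \<Rightarrow> bool list \<Rightarrow> bool list" where
  "tdf_eval S l ek x = crun (TDF_Eval S l) (ek @ x) []"

definition tdf_vrfy :: "tdf_skl \<Rightarrow> nat \<Rightarrow> bool list \<Rightarrow> bool list \<Rightarrow> bool" where
  "tdf_vrfy S l vk cert \<longleftrightarrow> crun (TDF_Vrfy S l) (vk @ cert) [] = [True]"

definition tdf_syntax :: "tdf_skl \<Rightarrow> bool" where
  "tdf_syntax S \<longleftrightarrow>
     poly_bounded (n_dom S) \<and>
     QPT (TDF_KG S) \<and> PPT (TDF_Samp S) \<and> PPT (TDF_Eval S) \<and>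
     QPT (TDF_Inv S) \<and> QPT (TDF_Del S) \<and> PPT (TDF_Vrfy S) \<and>
     (\<forall>l. has_qtype (TDF_KG S l) 0 0 (len_ek S l + len_vk S l) (len_td S l) \<and>
          has_ctype (TDF_Samp S l) (len_ek S l) (n_dom S l) \<and>
          has_ctype (TDF_Eval S l) (len_ek S l + n_dom S l) (len_y S l) \<and>
          c_coins (TDF_Eval S l) = 0 \<and>
          has_qtype (TDF_Inv S l) (len_y S l) (len_td S l) (n_dom S l) (len_td S l) \<and>
          has_qtype (TDF_Del S l) 0 (len_td S l) (len_cert S l) 0 \<and>
          has_ctype (TDF_Vrfy S l) (len_vk S l + len_cert S l) 1 \<and>
          c_coins (TDF_Vrfy S l) = 0)"

text \<open>Since \<open>tdf_kg S l ek vk\<close> is the trapdoor state scaled by the probability of the key, the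
  inner bound on the inversion probability is scaled by the same factor.\<close>

definition tdf_inversion_correct :: "tdf_skl \<Rightarrow> bool" where
  "tdf_inversion_correct S \<longleftrightarrow>
     (\<exists>\<epsilon> \<delta>. negligible \<epsilon> \<and> negligible \<delta> \<and>
       (\<forall>l. (\<Sum>(ek, vk) \<in> {(ek, vk). ek \<in> bits (len_ek S l) \<and> vk \<in> bits (len_vk S l) \<and>
                 (\<forall>x\<in>bits (n_dom S l).
                    qprob (TDF_Inv S l) (tdf_eval S l ek x) (tdf_kg S l ek vk) x
                      \<ge> (1 - \<delta> l) * qtrace (len_td S l) (tdf_kg S l ek vk))}.
              qtrace (len_td S l) (tdf_kg S l ek vk))
            \<ge> 1 - \<epsilon> l))"

definition tdf_deletion_correct :: "tdf_skl \<Rightarrow> bool" where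
  "tdf_deletion_correct S \<longleftrightarrow>
     (\<exists>\<epsilon>. negligible \<epsilon> \<and>
       (\<forall>l. (\<Sum>ek\<in>bits (len_ek S l). \<Sum>vk\<in>bits (len_vk S l).
              \<Sum>cert\<in>{cert \<in> bits (len_cert S l). tdf_vrfy S l vk cert}.
                qprob (TDF_Del S l) [] (tdf_kg S l ek vk) cert)
            \<ge> 1 - \<epsilon> l))"

text \<open>The two stages of an adversary share a quantum register of \<open>s l\<close> qubits.\<close>

definition ow_vra_adversary ::
    "tdf_skl \<Rightarrow> (nat \<Rightarrow> qcircuit) \<Rightarrow> (nat \<Rightarrow> qcircuit) \<Rightarrow> bool" where
  "ow_vra_adversary S A1 A2 \<longleftrightarrow>
     nonuniform_QPT A1 \<and> nonuniform_QPT A2 \<and>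
     (\<exists>s. \<forall>l. has_qtype (A1 l) (len_ek S l) (len_td S l) (len_cert S l) (s l) \<and>
              has_qtype (A2 l) (len_y S l + len_vk S l) (s l) (n_dom S l) 0)"

definition ow_vra_win ::
    "tdf_skl \<Rightarrow> (nat \<Rightarrow> qcircuit) \<Rightarrow> (nat \<Rightarrow> qcircuit) \<Rightarrow> nat \<Rightarrow> real" where
  "ow_vra_win S A1 A2 l =
     (\<Sum>ek\<in>bits (len_ek S l). \<Sum>vk\<in>bits (len_vk S l).
      \<Sum>cert\<in>{cert \<in> bits (len_cert S l). tdf_vrfy S l vk cert}.
        measure_pmf.expectation (tdf_samp S l ek)
          (\<lambda>x. qprob (A2 l) (tdf_eval S l ek x @ vk) (qrun (A1 l) ek (tdf_kg S l ek vk) cert) x))"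

definition ow_vra_secure :: "tdf_skl \<Rightarrow> bool" where
  "ow_vra_secure S \<longleftrightarrow>
     (\<forall>A1 A2. ow_vra_adversary S A1 A2 \<longrightarrow> negligible (ow_vra_win S A1 A2))"

definition is_tdf_skl :: "tdf_skl \<Rightarrow> bool" where
  "is_tdf_skl S \<longleftrightarrow>
     tdf_syntax S \<and> tdf_inversion_correct S \<and> tdf_deletion_correct S \<and> ow_vra_secure S"


section \<open>PKE-SKL with message space of single bits\<close>

text \<open>A decryption key consists of a classical string of \<open>pke_len_dkc\<close> bits and a register of
  \<open>pke_len_dkq\<close> qubits.  \<open>pke_kg l ek dkc vk\<close> is the state of that register scaled by the probability
  of the classical strings \<open>ek\<close>, \<open>dkc\<close>, \<open>vk\<close>; \<open>pke_dec l dkc \<rho> ct (m, dkc')\<close> is likewise the scaled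
  state of the register after decryption with result \<open>m\<close>, where \<open>None\<close> stands for failure;
  \<open>pke_del l dkc \<rho> cert\<close> is the probability of the certificate \<open>cert\<close>.\<close>

record pke_skl =
  pke_len_ek :: "nat \<Rightarrow> nat"
  pke_len_dkc :: "nat \<Rightarrow> nat"
  pke_len_dkq :: "nat \<Rightarrow> nat"
  pke_len_vk :: "nat \<Rightarrow> nat"
  pke_len_ct :: "nat \<Rightarrow> nat"
  pke_len_cert :: "nat \<Rightarrow> nat"
  pke_kg :: "nat \<Rightarrow> bool list \<Rightarrow> bool list \<Rightarrow> bool list \<Rightarrow> qop"
  pke_enc :: "nat \<Rightarrow> bool list \<Rightarrow> bool \<Rightarrow> bool list pmf"
  pke_dec :: "nat \<Rightarrow> bool list \<Rightarrow> qop \<Rightarrow> bool list \<Rightarrow> bool option \<times> bool list \<Rightarrow> qop"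
  pke_del :: "nat \<Rightarrow> bool list \<Rightarrow> qop \<Rightarrow> bool list \<Rightarrow> real"
  pke_vrfy :: "nat \<Rightarrow> bool list \<Rightarrow> bool list \<Rightarrow> bool"

text \<open>The first stage outputs \<open>cert @ [\<mu>0, \<mu>1]\<close>.\<close>

definition ind_vra_adversary ::
    "pke_skl \<Rightarrow> (nat \<Rightarrow> qcircuit) \<Rightarrow> (nat \<Rightarrow> qcircuit) \<Rightarrow> bool" where
  "ind_vra_adversary P A1 A2 \<longleftrightarrow>
     nonuniform_QPT A1 \<and> nonuniform_QPT A2 \<and>
     (\<exists>s. \<forall>l. has_qtype (A1 l) (pke_len_ek P l + pke_len_dkc P l) (pke_len_dkq P l)
                (pke_len_cert P l + 2) (s l) \<and>
              has_qtype (A2 l) (pke_len_ct P l + pke_len_vk P l) (s l) 1 0)"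

text \<open>The probability that the experiment with challenge bit \<open>b\<close> outputs 1.\<close>

definition ind_vra_exp ::
    "pke_skl \<Rightarrow> (nat \<Rightarrow> qcircuit) \<Rightarrow> (nat \<Rightarrow> qcircuit) \<Rightarrow> nat \<Rightarrow> bool \<Rightarrow> real" where
  "ind_vra_exp P A1 A2 l b =
     (\<Sum>ek\<in>bits (pke_len_ek P l). \<Sum>dkc\<in>bits (pke_len_dkc P l). \<Sum>vk\<in>bits (pke_len_vk P l).
      \<Sum>cert\<in>{cert \<in> bits (pke_len_cert P l). pke_vrfy P l vk cert}.
      \<Sum>\<mu>0\<in>UNIV. \<Sum>\<mu>1\<in>UNIV.
        measure_pmf.expectation (pke_enc P l ek (if b then \<mu>1 else \<mu>0))
          (\<lambda>ct. qprob (A2 l) (ct @ vk)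
                  (qrun (A1 l) (ek @ dkc) (pke_kg P l ek dkc vk) (cert @ [\<mu>0, \<mu>1])) [True]))"

definition ind_vra_secure :: "pke_skl \<Rightarrow> bool" where
  "ind_vra_secure P \<longleftrightarrow>
     (\<forall>A1 A2. ind_vra_adversary P A1 A2 \<longrightarrow>
        negligible (\<lambda>l. \<bar>ind_vra_exp P A1 A2 l False - ind_vra_exp P A1 A2 l True\<bar>))"


section \<open>The construction\<close>

definition skl_enc :: "tdf_skl \<Rightarrow> nat \<Rightarrow> bool list \<Rightarrow> bool \<Rightarrow> bool list pmf" where
  "skl_enc S l ek \<mu> =
     do {
       r \<leftarrow> pmf_of_set (bits (n_dom S l));
       x \<leftarrow> tdf_samp S l ek;
       return_pmf (tdf_eval S l ek x @ r @ [ip2 x r \<noteq> \<mu>])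
     }"

text \<open>The decryption unitary acts on the \<open>m\<close> wires of \<open>TDF_Inv\<close>, a result register of two qubits and
  an ancilla register of two qubits, in this order.  The classical values \<open>ek\<close>, \<open>y\<close>, \<open>r\<close>, \<open>b\<close> enter
  as parameters of the unitary (and \<open>y\<close> also as the classical input of \<open>TDF_Inv\<close>).\<close>

fun result_code :: "bool option \<Rightarrow> bool list" where
  "result_code None = [False, False]"
| "result_code (Some c) = [True, c]"

definition dec_result ::
    "tdf_skl \<Rightarrow> nat \<Rightarrow> bool list \<Rightarrow> bool list \<Rightarrow> bool list \<Rightarrow> bool \<Rightarrow> bool list \<Rightarrow> bool option" where
  "dec_result S l ek y r b x' =
     (if tdf_eval S l ek x' = y then Some (ip2 x' r \<noteq> b) else None)"

text \<open>XOR of the result into the result register: an involution on basis strings.\<close>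

definition xor_result ::
    "tdf_skl \<Rightarrow> nat \<Rightarrow> bool list \<Rightarrow> bool list \<Rightarrow> bool list \<Rightarrow> bool \<Rightarrow> bool list \<Rightarrow> bool list" where
  "xor_result S l ek y r b w =
     (let m = q_wires (TDF_Inv S l)
      in take m w
         @ map2 (\<noteq>) (take 2 (drop m w)) (result_code (dec_result S l ek y r b (take (n_dom S l) w)))
         @ drop (m + 2) w)"

definition dec_compute ::
    "tdf_skl \<Rightarrow> nat \<Rightarrow> bool list \<Rightarrow> bool list \<Rightarrow> bool list \<Rightarrow> bool \<Rightarrow> ket \<Rightarrow> ket" where
  "dec_compute S l ek y r b \<psi> =
     (\<lambda>w. apply_gates (q_gates (TDF_Inv S l)) \<psi> (xor_result S l ek y r b w))"

definition dec_uncompute ::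
    "tdf_skl \<Rightarrow> nat \<Rightarrow> bool list \<Rightarrow> bool list \<Rightarrow> bool list \<Rightarrow> bool \<Rightarrow> ket \<Rightarrow> ket" where
  "dec_uncompute S l ek y r b \<psi> =
     apply_gates (inverse_gates (q_gates (TDF_Inv S l))) (\<lambda>w. \<psi> (xor_result S l ek y r b w))"

definition dec_copy :: "nat \<Rightarrow> ket \<Rightarrow> ket" where
  "dec_copy m = apply_gates [Classical (CNOT m (m + 2)), Classical (CNOT (m + 1) (m + 3))]"

definition dec_unitary ::
    "tdf_skl \<Rightarrow> nat \<Rightarrow> bool list \<Rightarrow> bool list \<Rightarrow> bool list \<Rightarrow> bool \<Rightarrow> ket \<Rightarrow> ket" where
  "dec_unitary S l ek y r b =
     dec_uncompute S l ek y r b \<circ> dec_copy (q_wires (TDF_Inv S l)) \<circ> dec_compute S l ek y r b"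

text \<open>After uncomputing, the trapdoor register sits at its input position, directly behind \<open>y\<close>, and
  the ancilla register at the very end.\<close>

definition skl_dec ::
    "tdf_skl \<Rightarrow> nat \<Rightarrow> bool list \<Rightarrow> qop \<Rightarrow> bool list \<Rightarrow> bool option \<times> bool list \<Rightarrow> qop" where
  "skl_dec S l ek td ct out =
     (let (\<mu>, ek') = out;
          ly = len_y S l; n = n_dom S l; q = len_td S l; m = q_wires (TDF_Inv S l);
          y = take ly ct; r = take n (drop ly ct); b = last ct
      in if ek' \<noteq> ek then (\<lambda>_ _. 0)
         else if length ct \<noteq> ly + n + 1 then (if \<mu> = None then td else (\<lambda>_ _. 0))
         else measure_op (dec_unitary S l ek y r b) q
                (\<lambda>u. y @ u @ zeros (m - ly - q) @ zeros 4)
                (m + 2 - q)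
                (\<lambda>z u g. take ly g @ u @ drop ly g @ z)
                td (result_code \<mu>))"

definition PKESKL :: "tdf_skl \<Rightarrow> pke_skl" where
  "PKESKL S = \<lparr>
     pke_len_ek = len_ek S,
     pke_len_dkc = len_ek S,
     pke_len_dkq = len_td S,
     pke_len_vk = len_vk S,
     pke_len_ct = (\<lambda>l. len_y S l + n_dom S l + 1),
     pke_len_cert = len_cert S,
     pke_kg = (\<lambda>l ek dkc vk. if dkc = ek then tdf_kg S l ek vk else (\<lambda>_ _. 0)),
     pke_enc = skl_enc S,
     pke_dec = skl_dec S,
     pke_del = (\<lambda>l dkc td cert. qprob (TDF_Del S l) [] td cert),
     pke_vrfy = tdf_vrfy S \<rparr>"

end

(* Quantum Goldreich-Levin in the form of Adcock and Cleve. Let U be the second stage of an IND-VRA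
   adversary run on (y, r, c) and a pure state \<phi>. Prepare |r, c> uniformly, apply U to a copy,
   flip the phase of the output bit, undo everything and measure r. The amplitude of returning to
   the initial state with |x, 1> in place of |0, 0> is, up to sign, the advantage averaged over r,
   so its square is at most the squared norm of \<phi> times the probability of obtaining x. The sign
   coming from the pair of messages disappears in the square, so the reduction may discard the
   messages. To average over keys, certificates, x and the pure components of the state, the
   inequality B^2 <= N w is linearised to |B| <= (d N + w / d) / 2 for every d > 0; taking
   d = sqrt(win) at the end bounds the advantage by the square root of the OW-VRA winning
   probability. *)

theory Submission
  imports Defs
begin

section \<open>Sums over bit strings\<close>

text \<open>A classical Goldreich-Levin decoder asks the predictor about many r. Here the predictor
  owns one quantum register that can be neither cloned nor reset, so x has to come out of a single
  coherent run followed by its inverse. Two details make the amplitude right. The ciphertext bit c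
  is in superposition together with r because the adversary distinguishes rather than predicts: at
  the target |x, 1> the sign is (-1)^(x.r + c), so whatever does not depend on c cancels and the
  difference of two acceptance probabilities remains. Running the adversary on a copy of (r, c)
  leaves the original as an untouched label of the branch. The overlap is then diagonal in (r, c):
  without the label, cross terms between different strings would appear in place of acceptance
  probabilities. In the linearised inequality the same d serves all pure components, so both sides
  can be summed without knowing how the weight is spread over them.\<close>

lemma finite_bits [simp]: "finite (bits n)"
  using finite_lists_length_eq[of "UNIV :: bool set" n] by (simp add: bits_def)

lemma card_bits: "card (bits n) = 2 ^ n"
  using card_lists_length_eq[of "UNIV :: bool set" n] by (simp add: bits_def)

lemma bits_nonempty [simp]: "bits n \<noteq> {}"
  by (metis card_bits card.empty power_not_zero zero_neq_numeral)

lemma bits_0 [simp]: "bits 0 = {[]}"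
  by (auto simp: bits_def)

lemma in_bits [simp]: "w \<in> bits n \<longleftrightarrow> length w = n"
  by (simp add: bits_def)

lemma sum_bits_append:
  "(\<Sum>z\<in>bits (a + b). f z) = (\<Sum>x\<in>bits a. \<Sum>y\<in>bits b. f (x @ y))"
  unfolding sum.cartesian_product
  by (rule sum.reindex_bij_witness[of _ "\<lambda>(x, y). x @ y" "\<lambda>z. (take a z, drop a z)"]) auto

lemma sum_bits_1: "(\<Sum>w\<in>bits (Suc 0). f w) = f [False] + f [True]"
proof -
  have "bits (Suc 0) = {[False], [True]}"
    by (auto simp: length_Suc_conv)
  then show ?thesis by simp
qed

lemma sum_bits_Suc:
  "(\<Sum>w\<in>bits (Suc n). f w) = (\<Sum>w\<in>bits n. f (False # w)) + (\<Sum>w\<in>bits n. f (True # w))"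
  using sum_bits_append[of f 1 n] by (simp add: sum_bits_1)

lemma sum_bits_snoc:
  "(\<Sum>w\<in>bits (Suc n). f w) = (\<Sum>w\<in>bits n. f (w @ [False]) + f (w @ [True]))"
  using sum_bits_append[of f n 1] by (simp add: sum_bits_1)

lemma sum_bits_2:
  "(\<Sum>w\<in>bits 2. f w) = (\<Sum>a\<in>UNIV. \<Sum>b\<in>UNIV. f [a, b])"
  by (simp add: numeral_2_eq_2 sum_bits_Suc UNIV_bool ac_simps)

text \<open>Each string is one of the two updates both of itself and of its flip at
  \<open>i\<close>, hence is counted twice. A Hadamard gate mixes exactly these two
  amplitudes.\<close>

lemma sum_bits_update:
  fixes f :: "bool list \<Rightarrow> 'a::comm_semiring_1"
  assumes "i < m"
  shows "(\<Sum>w\<in>bits m. f (w[i := False]) + f (w[i := True])) = 2 * (\<Sum>w\<in>bits m. f w)"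
proof -
  let ?flip = "\<lambda>w. w[i := \<not> w ! i]"
  have "f (w[i := False]) + f (w[i := True]) = f w + f (?flip w)" if "w \<in> bits m" for w
    using that assms by (cases "w ! i") (metis (full_types) add.commute list_update_id)+
  moreover have "(\<Sum>w\<in>bits m. f (?flip w)) = (\<Sum>w\<in>bits m. f w)"
    by (rule sum.reindex_bij_witness[of _ ?flip ?flip]) (use assms in auto)
  ultimately show ?thesis
    by (simp add: sum.distrib mult_2)
qed

section \<open>The inner product modulo 2 and its characters\<close>

lemma ip2_Nil [simp]: "\<not> ip2 [] r"
  by (simp add: ip2_def)

lemma ip2_Cons [simp]: "ip2 (a # x) (b # r) \<longleftrightarrow> ((a \<and> b) \<noteq> ip2 x r)"
proof -
  have "{i. i < length (a # x) \<and> (a # x) ! i \<and> (b # r) ! i}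
      = (if a \<and> b then {0} else {}) \<union> Suc ` {i. i < length x \<and> x ! i \<and> r ! i}"
    by (auto simp: less_Suc_eq_0_disj)
  moreover have "card (Suc ` A) = card A" for A
    by (simp add: card_image)
  ultimately show ?thesis
    by (auto simp: ip2_def)
qed

lemma ip2_snoc:
  "length x = length r \<Longrightarrow> ip2 (x @ [a]) (r @ [b]) \<longleftrightarrow> (ip2 x r \<noteq> (a \<and> b))"
  by (induction x r rule: list_induct2) auto

lemma ip2_zeros [simp]: "\<not> ip2 (zeros n) r"
proof -
  have "{i. i < n \<and> zeros n ! i \<and> r ! i} = {}" by auto
  then show ?thesis unfolding ip2_def length_replicate by (metis card.empty even_zero)
qed

text \<open>A character of the strings under exclusive or; up to normalisation, an entry of the
  Walsh-Hadamard matrix.\<close>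

definition ip_sign :: "bool list \<Rightarrow> bool list \<Rightarrow> complex" where
  "ip_sign x r = (if ip2 x r then - 1 else 1)"


section \<open>Circuits as linear operators\<close>

definition wf_gates :: "nat \<Rightarrow> gate list \<Rightarrow> bool" where
  "wf_gates m gs \<longleftrightarrow> (\<forall>g\<in>set gs. distinct (gate_wires g) \<and> set (gate_wires g) \<subseteq> {..<m})"

lemma wf_gates_simps [simp]:
  "wf_gates m []"
  "wf_gates m (g # gs) \<longleftrightarrow>
     distinct (gate_wires g) \<and> set (gate_wires g) \<subseteq> {..<m} \<and> wf_gates m gs"
  "wf_gates m (gs @ hs) \<longleftrightarrow> wf_gates m gs \<and> wf_gates m hs"
  "wf_gates m (rev gs) \<longleftrightarrow> wf_gates m gs"
  by (auto simp: wf_gates_def)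

lemma wf_gates_mono: "wf_gates m gs \<Longrightarrow> m \<le> m' \<Longrightarrow> wf_gates m' gs"
  by (fastforce simp: wf_gates_def)

lemma apply_gates_simps [simp]:
  "apply_gates [] \<psi> = \<psi>"
  "apply_gates (g # gs) \<psi> = apply_gates gs (apply_gate g \<psi>)"
  "apply_gates (gs @ hs) \<psi> = apply_gates hs (apply_gates gs \<psi>)"
  by (simp_all add: apply_gates_def)

lemma inverse_gates_simps [simp]:
  "inverse_gates [] = []"
  "inverse_gates (g # gs) = inverse_gates gs @ [inverse_gate g]"
  by (simp_all add: inverse_gates_def)

lemma gate_wires_inverse [simp]: "gate_wires (inverse_gate g) = gate_wires g"
  by (cases g) auto

lemma wf_inverse_gates [simp]: "wf_gates m (inverse_gates gs) \<longleftrightarrow> wf_gates m gs"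
  by (induction gs) auto

lemma length_inverse_gates [simp]: "length (inverse_gates gs) = length gs"
  by (simp add: inverse_gates_def)

lemma inverse_inverse_gates [simp]: "inverse_gates (inverse_gates gs) = gs"
proof -
  have "inverse_gate (inverse_gate g) = g" for g by (cases g) auto
  then show ?thesis by (simp add: inverse_gates_def rev_map o_def)
qed

lemma length_apply_cgate [simp]: "length (apply_cgate g w) = length w"
  by (cases g) auto

lemma length_fold_apply_cgate [simp]: "length (fold apply_cgate gs w) = length w"
  by (induction gs arbitrary: w) auto

lemma apply_cgate_involution:
  assumes "distinct (cgate_wires g)" "set (cgate_wires g) \<subseteq> {..<length w}"
  shows "apply_cgate g (apply_cgate g w) = w"
  using assms by (cases g) (auto simp: list_eq_iff_nth_eq nth_list_update)

lemma fold_apply_cgate_rev: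
  assumes "wf_gates (length w) (map Classical gs)"
  shows "fold apply_cgate (rev gs) (fold apply_cgate gs w) = w"
  using assms by (induction gs arbitrary: w) (auto simp: apply_cgate_involution)

text \<open>Kets are functions on strings of every length, and many identities below hold at length
  \<open>m\<close> only. A gate reads amplitudes at strings of the same length, so such an identity
  survives under it.\<close>

lemma apply_gate_cong:
  assumes "\<And>w. length w = m \<Longrightarrow> \<psi> w = \<psi>' w" "length w = m"
  shows "apply_gate g \<psi> w = apply_gate g \<psi>' w"
  using assms by (cases g) auto

lemma apply_gates_cong:
  assumes "\<And>w. length w = m \<Longrightarrow> \<psi> w = \<psi>' w" "length w = m"
  shows "apply_gates gs \<psi> w = apply_gates gs \<psi>' w"
  using assms
proof (induction gs arbitrary: \<psi> \<psi>')
  case (Cons g gs)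
  show ?case
    unfolding apply_gates_simps
    by (rule Cons.IH) (use Cons.prems apply_gate_cong in blast)+
qed auto

lemma apply_gate_sum:
  "apply_gate g (\<lambda>w. \<Sum>i\<in>I. c i * \<psi> i w) = (\<lambda>w. \<Sum>i\<in>I. c i * apply_gate g (\<psi> i) w)"
proof (cases g)
  case (H j)
  have "((\<Sum>i\<in>I. c i * \<psi> i u) + a * (\<Sum>i\<in>I. c i * \<psi> i v)) / b
      = (\<Sum>i\<in>I. c i * ((\<psi> i u + a * \<psi> i v) / b))" for u v and a b :: complex
    unfolding sum_distrib_left sum.distrib[symmetric] sum_divide_distrib
    by (rule sum.cong) (simp_all add: algebra_simps add_divide_distrib)
  then show ?thesis
    unfolding H apply_gate.simps by (intro ext)
qed (simp_all add: fun_eq_iff sum_distrib_left mult.left_commute)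

lemma apply_gates_sum:
  "apply_gates gs (\<lambda>w. \<Sum>i\<in>I. c i * \<psi> i w) = (\<lambda>w. \<Sum>i\<in>I. c i * apply_gates gs (\<psi> i) w)"
  by (induction gs arbitrary: \<psi>) (simp_all add: apply_gate_sum)

lemma apply_gates_zero: "apply_gates gs (\<lambda>_. 0) = (\<lambda>_. 0)"
  using apply_gates_sum[where I = "{}"] by simp

lemma apply_gate_append:
  assumes "set (gate_wires g) \<subseteq> {..<length v}"
  shows "apply_gate g \<psi> (v @ t) = apply_gate g (\<lambda>v. \<psi> (v @ t)) v"
proof (cases g)
  case (Classical c)
  then show ?thesis
    using assms by (cases c) (auto simp: nth_append list_update_append)
qed (use assms in \<open>auto simp: nth_append list_update_append\<close>)

text \<open>Tensoring with the identity: the wires behind \<open>v\<close> are never touched, so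
  \<open>t\<close> is a mere parameter.\<close>

lemma apply_gates_append_wires:
  assumes "wf_gates (length v) gs"
  shows "apply_gates gs \<psi> (v @ t) = apply_gates gs (\<lambda>v. \<psi> (v @ t)) v"
  using assms
proof (induction gs arbitrary: \<psi>)
  case (Cons g gs)
  then show ?case
    by (auto intro!: apply_gates_cong[where m = "length v"] apply_gate_append)
qed auto

lemma apply_gates_basis_append:
  assumes "wf_gates (length v') gs" "length t' = length t"
  shows "apply_gates gs (basis_ket (v @ t)) (v' @ t')
       = (if t' = t then apply_gates gs (basis_ket v) v' else 0)"
proof -
  have "(\<lambda>w. basis_ket (v @ t) (w @ t')) = (if t' = t then basis_ket v else (\<lambda>_. 0))"
    using assms(2) by (auto simp: basis_ket_def)
  then show ?thesis
    using assms(1) by (simp add: apply_gates_append_wires apply_gates_zero)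
qed

text \<open>Classical gates act on kets by precomposition, so the amplitude at \<open>w\<close> is
  found by running the list backwards from \<open>w\<close>.\<close>

lemma apply_gates_Classical:
  "apply_gates (map Classical cs) \<psi> w = \<psi> (fold apply_cgate (rev cs) w)"
  by (induction cs arbitrary: \<psi>) auto

lemma apply_gates_Classical_basis:
  assumes "wf_gates m (map Classical cs)" "length v = m" "length w = m"
  shows "apply_gates (map Classical cs) (basis_ket v) w = basis_ket (fold apply_cgate cs v) w"
proof -
  have "fold apply_cgate cs (fold apply_cgate (rev cs) w) = w"
    using fold_apply_cgate_rev[of w "rev cs"] assms by (simp flip: rev_map)
  moreover have "fold apply_cgate (rev cs) (fold apply_cgate cs v) = v"
    using fold_apply_cgate_rev assms by blast
  ultimately have "fold apply_cgate (rev cs) w = v \<longleftrightarrow> w = fold apply_cgate cs v"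
    by metis
  then show ?thesis
    by (simp only: apply_gates_Classical basis_ket_def)
qed

lemma apply_gate_inverse:
  assumes "distinct (gate_wires g)" "set (gate_wires g) \<subseteq> {..<length w}"
  shows "apply_gate (inverse_gate g) (apply_gate g \<psi>) w = \<psi> w"
proof (cases g)
  case (H i)
  have s: "complex_of_real (sqrt 2) * complex_of_real (sqrt 2) = 2"
    by (simp flip: of_real_mult)
  have "w = w[i := w ! i]" by simp
  then show ?thesis
    using assms H by (cases "w ! i") (auto simp: divide_simps s algebra_simps)
qed (use assms in \<open>auto simp: apply_cgate_involution cis_mult\<close>)

lemma apply_gates_inverse:
  assumes "wf_gates (length w) gs"
  shows "apply_gates (inverse_gates gs) (apply_gates gs \<psi>) w = \<psi> w"
  using assms
proof (induction gs arbitrary: \<psi> w)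
  case (Cons g gs)
  have "apply_gates (inverse_gates (g # gs)) (apply_gates (g # gs) \<psi>) w
      = apply_gate (inverse_gate g) (apply_gate g \<psi>) w"
    unfolding inverse_gates_simps apply_gates_simps
    by (rule apply_gate_cong[where m = "length w"]) (use Cons in auto)
  then show ?case
    using Cons.prems by (simp add: apply_gate_inverse)
qed auto

section \<open>Unitarity of gate lists\<close>

definition ket_inner :: "nat \<Rightarrow> ket \<Rightarrow> ket \<Rightarrow> complex" where
  "ket_inner m \<psi> \<xi> = (\<Sum>w\<in>bits m. cnj (\<psi> w) * \<xi> w)"

lemma ket_inner_cong:
  assumes "\<And>w. length w = m \<Longrightarrow> \<psi> w = \<psi>' w" "\<And>w. length w = m \<Longrightarrow> \<xi> w = \<xi>' w"
  shows "ket_inner m \<psi> \<xi> = ket_inner m \<psi>' \<xi>'"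
  using assms by (simp add: ket_inner_def)

lemma ket_inner_self:
  "ket_inner m \<psi> \<psi> = complex_of_real (\<Sum>w\<in>bits m. (cmod (\<psi> w))\<^sup>2)"
  unfolding ket_inner_def of_real_sum
  by (simp only: complex_norm_square mult.commute)

lemma ket_inner_apply_gate:
  assumes "distinct (gate_wires g)" "set (gate_wires g) \<subseteq> {..<m}"
  shows "ket_inner m (apply_gate g \<psi>) (apply_gate g \<xi>) = ket_inner m \<psi> \<xi>"
proof (cases g)
  case (Classical c)
  show ?thesis
    unfolding Classical ket_inner_def apply_gate.simps
    by (rule sum.reindex_bij_witness[of _ "apply_cgate c" "apply_cgate c"])
       (use Classical assms in \<open>auto simp: apply_cgate_involution\<close>)
next
  case (H i)
  let ?h = "\<lambda>w. cnj (apply_gate g \<psi> w) * apply_gate g \<xi> w"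
  let ?k = "\<lambda>w. cnj (\<psi> w) * \<xi> w"
  have s: "complex_of_real (sqrt 2) * complex_of_real (sqrt 2) = 2"
    by (simp flip: of_real_mult)
  have i: "i < m" using assms H by simp
  \<comment> \<open>The summands are not preserved one by one, but the two belonging to the values
    of wire \<open>i\<close> are preserved together, since the 2x2 Hadamard matrix is
    orthogonal.\<close>
  have "?h (w[i := False]) + ?h (w[i := True]) = ?k (w[i := False]) + ?k (w[i := True])"
    if "w \<in> bits m" for w
    using that i H by (simp add: divide_simps s) (simp add: algebra_simps)
  then have "2 * (\<Sum>w\<in>bits m. ?h w) = 2 * (\<Sum>w\<in>bits m. ?k w)"
    unfolding sum_bits_update[OF i, symmetric] by (rule sum.cong[OF refl])
  then show ?thesis
    by (simp add: ket_inner_def)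
qed (auto simp: ket_inner_def cis_cnj cis_mult intro!: sum.cong)

lemma ket_inner_apply_gates:
  "wf_gates m gs \<Longrightarrow> ket_inner m (apply_gates gs \<psi>) (apply_gates gs \<xi>) = ket_inner m \<psi> \<xi>"
  by (induction gs arbitrary: \<psi> \<xi>) (auto simp: ket_inner_apply_gate)

section \<open>The phase flip and the Walsh-Hadamard transform\<close>

lemma apply_gates_T4:
  "apply_gates (replicate 4 (T i)) \<psi> w = (if w ! i then - 1 else 1) * \<psi> w"
proof -
  \<comment> \<open>The gate set offers the phase flip only as the fourth power of
    \<open>T\<close>.\<close>
  have "cis (pi / 4) ^ 4 = - 1"
    by (simp add: Complex.DeMoivre)
  then have "cis (pi / 4) * (cis (pi / 4) * (cis (pi / 4) * cis (pi / 4))) = - 1"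
    by (simp add: power4_eq_xxxx mult.assoc)
  then show ?thesis
    by (simp add: numeral_eq_Suc)
qed

text \<open>Induction on the block: once its Hadamard gate is applied, the first wire joins the
  prefix, so \<open>v\<close> must stay arbitrary.\<close>

lemma apply_gates_H_block:
  "apply_gates (map H [length v..<length v + length t]) \<psi> (v @ t)
     = (\<Sum>\<tau>\<in>bits (length t). ip_sign \<tau> t * \<psi> (v @ \<tau>)) / complex_of_real (sqrt 2) ^ length t"
proof (induction t arbitrary: v \<psi>)
  case Nil
  then show ?case by (simp add: ip_sign_def)
next
  case (Cons b t)
  let ?c = "complex_of_real (sqrt 2)"
  have "apply_gates (map H [length v..<length v + length (b # t)]) \<psi> (v @ b # t)
      = apply_gates (map H [length (v @ [b])..<length (v @ [b]) + length t])
          (apply_gate (H (length v)) \<psi>) ((v @ [b]) @ t)"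
    by (simp add: upt_conv_Cons del: upt_Suc)
  also have "\<dots> = (\<Sum>\<tau>\<in>bits (length t).
      ip_sign \<tau> t * apply_gate (H (length v)) \<psi> (v @ b # \<tau>)) / ?c ^ length t"
    by (subst Cons.IH) simp
  also have "\<dots> = (\<Sum>\<tau>\<in>bits (length t). (ip_sign (False # \<tau>) (b # t) * \<psi> (v @ False # \<tau>)
      + ip_sign (True # \<tau>) (b # t) * \<psi> (v @ True # \<tau>)) / ?c) / ?c ^ length t"
    by (intro arg_cong2[where f = "(/)"] sum.cong refl)
       (auto simp: ip_sign_def list_update_append nth_append field_simps)
  finally show ?case
    by (simp add: sum_bits_Suc sum.distrib flip: sum_divide_distrib)
qed

text \<open>The same transform as an explicit superposition of basis kets, the form in which
  linearity carries it through later gates.\<close>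

lemma apply_gates_H_block_basis:
  assumes "length v' = length v" "length t = length \<tau>"
  shows "apply_gates (map H [length v..<length v + length \<tau>]) (basis_ket (v @ \<tau>)) (v' @ t)
       = (\<Sum>\<sigma>\<in>bits (length \<tau>). ip_sign \<tau> \<sigma> / complex_of_real (sqrt 2) ^ length \<tau>
            * basis_ket (v @ \<sigma>) (v' @ t))"
proof -
  have "apply_gates (map H [length v'..<length v' + length t]) (basis_ket (v @ \<tau>)) (v' @ t)
     = (\<Sum>\<sigma>\<in>bits (length t). ip_sign \<sigma> t * basis_ket (v @ \<tau>) (v' @ \<sigma>))
         / complex_of_real (sqrt 2) ^ length t"
    by (rule apply_gates_H_block)
  also have "(\<Sum>\<sigma>\<in>bits (length t). ip_sign \<sigma> t * basis_ket (v @ \<tau>) (v' @ \<sigma>))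
      = (\<Sum>\<sigma>\<in>bits (length t). if \<sigma> = \<tau> then (if v' = v then ip_sign \<tau> t else 0) else 0)"
    using assms by (intro sum.cong) (auto simp: basis_ket_def)
  also have "\<dots> = (if v' = v then ip_sign \<tau> t else 0)"
    using assms by simp
  also have "\<dots> / complex_of_real (sqrt 2) ^ length t
      = (\<Sum>\<sigma>\<in>bits (length \<tau>). if \<sigma> = t then
           (if v' = v then ip_sign \<tau> t / complex_of_real (sqrt 2) ^ length \<tau> else 0) else 0)"
    using assms by simp
  also have "\<dots> = (\<Sum>\<sigma>\<in>bits (length \<tau>). ip_sign \<tau> \<sigma> / complex_of_real (sqrt 2) ^ length \<tau>
            * basis_ket (v @ \<sigma>) (v' @ t))"
    using assms by (intro sum.cong) (auto simp: basis_ket_def)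
  finally show ?thesis
    using assms by simp
qed


section \<open>Moving and copying blocks of wires\<close>

text \<open>The usual exchange of two bits by three alternating exclusive ors.\<close>

definition swap_adjacent :: "nat \<Rightarrow> cgate list" where
  "swap_adjacent i = [CNOT i (Suc i), CNOT (Suc i) i, CNOT i (Suc i)]"

text \<open>Carries the bit on wire \<open>i + p\<close> leftwards to wire \<open>i\<close>,
  shifting the \<open>p\<close> wires in between.\<close>

primrec bubble :: "nat \<Rightarrow> nat \<Rightarrow> cgate list" where
  "bubble i 0 = []"
| "bubble i (Suc p) = bubble (Suc i) p @ swap_adjacent i"

text \<open>Swaps the adjacent blocks of \<open>p\<close> and \<open>k\<close> wires starting at
  \<open>i\<close>: each bit of the second block in turn is carried past the whole first
  block.\<close>

primrec exchange :: "nat \<Rightarrow> nat \<Rightarrow> nat \<Rightarrow> cgate list" where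
  "exchange i p 0 = []"
| "exchange i p (Suc k) = bubble i p @ exchange (Suc i) p k"

definition copy_block :: "nat \<Rightarrow> nat \<Rightarrow> nat \<Rightarrow> cgate list" where
  "copy_block i j k = map (\<lambda>d. CNOT (i + d) (j + d)) [0..<k]"

lemma fold_bubble:
  "fold apply_cgate (bubble (length a) (length b)) (a @ b @ x # d) = a @ x # b @ d"
proof (induction b arbitrary: a)
  case (Cons y b)
  have "fold apply_cgate (bubble (Suc (length a)) (length b)) (a @ y # b @ x # d)
      = a @ y # x # b @ d"
    using Cons.IH[of "a @ [y]"] by simp
  then show ?case
    by (auto simp: swap_adjacent_def list_update_append nth_append)
qed auto

lemma fold_exchange:
  "fold apply_cgate (exchange (length a) (length b) (length c)) (a @ b @ c @ d) = a @ c @ b @ d"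
proof (induction c arbitrary: a)
  case (Cons x c)
  show ?case
    using Cons.IH[of "a @ [x]"] by (simp add: fold_bubble)
qed auto

lemma fold_exchange':
  assumes "length a = i" "length b = p" "length c = k"
  shows "fold apply_cgate (exchange i p k) (a @ b @ c @ d) = a @ c @ b @ d"
  using fold_exchange assms by blast

lemma wf_bubble: "i + p < m \<Longrightarrow> wf_gates m (map Classical (bubble i p))"
  by (induction p arbitrary: i) (auto simp: swap_adjacent_def)

lemma wf_exchange: "i + p + k \<le> m \<Longrightarrow> wf_gates m (map Classical (exchange i p k))"
  by (induction k arbitrary: i) (auto simp: wf_bubble)

lemma fold_rev_exchange:
  assumes "length a = i" "length b = p" "length c = k"
  shows "fold apply_cgate (rev (exchange i p k)) (a @ c @ b @ d) = a @ b @ c @ d"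
  using fold_apply_cgate_rev[of "a @ b @ c @ d" "exchange i p k"] assms
  by (simp add: wf_exchange fold_exchange')

lemma length_bubble: "length (bubble i p) = 3 * p"
  by (induction p arbitrary: i) (auto simp: swap_adjacent_def)

lemma length_exchange: "length (exchange i p k) = 3 * p * k"
  by (induction k arbitrary: i) (auto simp: length_bubble algebra_simps)

lemma length_copy_block [simp]: "length (copy_block i j k) = k"
  by (simp add: copy_block_def)

lemma wf_copy_block:
  "(0 < k \<Longrightarrow> i \<noteq> j) \<Longrightarrow> i + k \<le> m \<Longrightarrow> j + k \<le> m \<Longrightarrow> wf_gates m (map Classical (copy_block i j k))"
  by (auto simp: copy_block_def wf_gates_def)

lemma copy_block_Suc:
  "copy_block i j (Suc k) = CNOT i j # copy_block (Suc i) (Suc j) k"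
  by (simp add: copy_block_def upt_conv_Cons map_Suc_upt[symmetric] o_def del: upt_Suc)

lemma fold_copy_block_right:
  "length t = k \<Longrightarrow> fold apply_cgate (copy_block (length a + k + length b) (length a) k)
     (a @ zeros k @ b @ t @ d) = a @ t @ b @ t @ d"
proof -
  have "fold apply_cgate (copy_block (length a + length t + length b) (length a) (length t))
     (a @ zeros (length t) @ b @ t @ d) = a @ t @ b @ t @ d" for a b t d
  proof (induction t arbitrary: a b)
    case Nil
    then show ?case by (simp add: copy_block_def)
  next
    case (Cons x t)
    show ?case
      \<comment> \<open>A bit already used leaves the source and joins the gap \<open>b\<close>,
        while its copy joins \<open>a\<close>; the distance from target to source is
        unchanged.\<close>
      using Cons.IH[of "a @ [x]" "b @ [x]"]
      by (simp add: copy_block_Suc list_update_append nth_append)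
  qed
  then show "length t = k \<Longrightarrow> ?thesis" by blast
qed

lemma fold_copy_block_left:
  "length t = k \<Longrightarrow> fold apply_cgate (copy_block 0 k k) (t @ zeros k @ d) = t @ t @ d"
proof -
  have "fold apply_cgate (copy_block (length a) (length a + length t + length b) (length t))
     (a @ t @ b @ zeros (length t) @ d) = a @ t @ b @ t @ d" for a b t d
  proof (induction t arbitrary: a b)
    case Nil
    then show ?case by (simp add: copy_block_def)
  next
    case (Cons x t)
    show ?case
      using Cons.IH[of "a @ [x]" "b @ [x]"]
      by (simp add: copy_block_Suc list_update_append nth_append)
  qed
  from this[of "[]" t "[]" d] show "length t = k \<Longrightarrow> ?thesis" by simp
qed

section \<open>Running a circuit on a mixture of pure states\<close>

definition pure :: "ket \<Rightarrow> qop" where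
  "pure \<phi> = (\<lambda>u v. \<phi> u * cnj (\<phi> v))"

text \<open>The cone generated by rank-one operators, with scalars absorbed into the kets. All
  states of the games lie in it, so properties additive in the operator follow from the pure case by
  induction, without a spectral decomposition.\<close>

inductive pos_op :: "qop \<Rightarrow> bool" where
  zero: "pos_op (\<lambda>_ _. 0)"
| pure: "pos_op (pure \<phi>)"
| add: "pos_op \<rho> \<Longrightarrow> pos_op \<sigma> \<Longrightarrow> pos_op (\<lambda>u v. \<rho> u v + \<sigma> u v)"

lemma pos_op_sum:
  assumes "finite I" "\<And>i. i \<in> I \<Longrightarrow> pos_op (\<rho> i)"
  shows "pos_op (\<lambda>u v. \<Sum>i\<in>I. \<rho> i u v)"
  using assms by (induction I) (auto intro: pos_op.intros)

lemma pos_op_no_qubits: "pos_op no_qubits"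
  using pos_op.pure[of "\<lambda>_. 1"] by (simp add: pure_def no_qubits_def)

definition input_ket :: "qcircuit \<Rightarrow> bool list \<Rightarrow> ket \<Rightarrow> ket" where
  "input_ket C s \<phi> = (\<lambda>w. \<Sum>u\<in>bits (q_qin C).
     \<phi> u * basis_ket (s @ u @ zeros (q_wires C - q_cin C - q_qin C)) w)"

definition output_ket :: "qcircuit \<Rightarrow> bool list \<Rightarrow> ket \<Rightarrow> ket" where
  "output_ket C s \<phi> = apply_gates (q_gates C) (input_ket C s \<phi>)"

lemma output_ket_alt:
  "output_ket C s \<phi> w = (\<Sum>u\<in>bits (q_qin C). \<phi> u *
     apply_gates (q_gates C) (basis_ket (s @ u @ zeros (q_wires C - q_cin C - q_qin C))) w)"
  unfolding output_ket_def input_ket_def by (simp add: apply_gates_sum)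

lemma wf_qcircuit_gates: "wf_qcircuit C \<Longrightarrow> wf_gates (q_wires C) (q_gates C)"
  by (simp add: wf_qcircuit_def wf_gates_def)

lemma qrun_zero: "qrun C s (\<lambda>_ _. 0) z = (\<lambda>_ _. 0)"
  by (simp add: qrun_def measure_op_def)

lemma qrun_add:
  "qrun C s (\<lambda>u v. \<rho> u v + \<sigma> u v) z = (\<lambda>u v. qrun C s \<rho> z u v + qrun C s \<sigma> z u v)"
  by (simp add: qrun_def measure_op_def sum.distrib[symmetric] algebra_simps)

text \<open>Discarding wires is measuring them and forgetting the outcome \<open>g\<close>; given
  \<open>z\<close> and \<open>g\<close> the remaining state is pure.\<close>

lemma qrun_pure:
  "qrun C s (pure \<phi>) z u v = (\<Sum>g\<in>bits (q_wires C - q_cout C - q_qout C).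
     pure (\<lambda>u. output_ket C s \<phi> (z @ u @ g)) u v)"
  unfolding qrun_def measure_op_def pure_def output_ket_alt cnj_sum sum_product
  by (simp add: ac_simps)

lemma pos_op_qrun:
  assumes "pos_op \<rho>"
  shows "pos_op (qrun C s \<rho> z)"
  using assms
proof induction
  case (pure \<phi>)
  have "pos_op (\<lambda>u v. \<Sum>g\<in>bits (q_wires C - q_cout C - q_qout C).
     pure (\<lambda>u. output_ket C s \<phi> (z @ u @ g)) u v)"
    by (intro pos_op_sum pos_op.pure) auto
  then show ?case by (simp only: qrun_pure[abs_def])
qed (auto simp: qrun_zero qrun_add intro: pos_op.intros)

lemma qtrace_zero [simp]: "qtrace q (\<lambda>_ _. 0) = 0"
  by (simp add: qtrace_def)

lemma qtrace_add: "qtrace q (\<lambda>u v. \<rho> u v + \<sigma> u v) = qtrace q \<rho> + qtrace q \<sigma>"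
  by (simp add: qtrace_def sum.distrib)

lemma qtrace_sum:
  "finite I \<Longrightarrow> qtrace q (\<lambda>u v. \<Sum>i\<in>I. \<rho> i u v) = (\<Sum>i\<in>I. qtrace q (\<rho> i))"
  by (induction I rule: finite_induct) (simp_all add: qtrace_add)

lemma qtrace_pure: "qtrace q (pure \<phi>) = (\<Sum>u\<in>bits q. (cmod (\<phi> u))\<^sup>2)"
  unfolding qtrace_def pure_def complex_norm_square[symmetric] of_real_sum[symmetric] by simp

lemma qtrace_nonneg: "pos_op \<rho> \<Longrightarrow> 0 \<le> qtrace q \<rho>"
  by (induction rule: pos_op.induct) (auto simp: qtrace_add qtrace_pure intro: sum_nonneg)

lemma qprob_zero [simp]: "qprob C s (\<lambda>_ _. 0) z = 0"
  by (simp add: qprob_def qrun_zero)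

lemma qprob_add:
  "qprob C s (\<lambda>u v. \<rho> u v + \<sigma> u v) z = qprob C s \<rho> z + qprob C s \<sigma> z"
  by (simp add: qprob_def qrun_add qtrace_add)

lemma qprob_sum:
  "finite I \<Longrightarrow> qprob C s (\<lambda>u v. \<Sum>i\<in>I. \<rho> i u v) z = (\<Sum>i\<in>I. qprob C s (\<rho> i) z)"
  by (induction I rule: finite_induct) (simp_all add: qprob_add)

lemma qprob_pure:
  "qprob C s (pure \<phi>) z = (\<Sum>u\<in>bits (q_qout C). \<Sum>g\<in>bits (q_wires C - q_cout C - q_qout C).
     (cmod (output_ket C s \<phi> (z @ u @ g)))\<^sup>2)"
  unfolding qprob_def qrun_pure[abs_def]
  by (simp add: qtrace_sum qtrace_pure) (rule sum.swap)

lemma qprob_nonneg: "pos_op \<rho> \<Longrightarrow> 0 \<le> qprob C s \<rho> z"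
  by (simp add: qprob_def qtrace_nonneg pos_op_qrun)

lemma ket_inner_basis_sum:
  assumes "\<And>i. i \<in> I \<Longrightarrow> length (e i) = m"
  shows "ket_inner m (\<lambda>w. \<Sum>i\<in>I. c i * basis_ket (e i) w) \<psi> = (\<Sum>i\<in>I. cnj (c i) * \<psi> (e i))"
proof -
  have "ket_inner m (\<lambda>w. \<Sum>i\<in>I. c i * basis_ket (e i) w) \<psi>
      = (\<Sum>i\<in>I. \<Sum>w\<in>bits m. cnj (c i * basis_ket (e i) w) * \<psi> w)"
    unfolding ket_inner_def cnj_sum sum_distrib_right by (rule sum.swap)
  also have "\<dots> = (\<Sum>i\<in>I. \<Sum>w\<in>bits m. if w = e i then cnj (c i) * \<psi> (e i) else 0)"
    by (intro sum.cong) (auto simp: basis_ket_def)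
  finally show ?thesis
    using assms by simp
qed

lemma input_ket_basis:
  assumes "length u = q_qin C"
  shows "input_ket C s \<phi> (s @ u @ zeros (q_wires C - q_cin C - q_qin C)) = \<phi> u"
proof -
  have "input_ket C s \<phi> (s @ u @ zeros (q_wires C - q_cin C - q_qin C))
      = (\<Sum>u'\<in>bits (q_qin C). if u' = u then \<phi> u else 0)"
    unfolding input_ket_def using assms by (intro sum.cong) (auto simp: basis_ket_def)
  then show ?thesis
    using assms by simp
qed

lemma norm_output_ket:
  assumes "wf_qcircuit C" "length s = q_cin C"
  shows "(\<Sum>w\<in>bits (q_wires C). (cmod (output_ket C s \<phi> w))\<^sup>2) = qtrace (q_qin C) (pure \<phi>)"
proof -
  let ?m = "q_wires C"
  have "complex_of_real (\<Sum>w\<in>bits ?m. (cmod (output_ket C s \<phi> w))\<^sup>2)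
      = ket_inner ?m (input_ket C s \<phi>) (input_ket C s \<phi>)"
    unfolding ket_inner_self[symmetric] output_ket_def
    by (intro ket_inner_apply_gates wf_qcircuit_gates assms)
  \<comment> \<open>Only the left argument is expanded into basis kets; it then reads off the
    amplitudes of the right one, which \<open>input_ket_basis\<close> supplies.\<close>
  also have "\<dots> = (\<Sum>u\<in>bits (q_qin C). cnj (\<phi> u) * \<phi> u)"
    unfolding input_ket_def[of C s \<phi>, THEN arg_cong[where f = "\<lambda>x. ket_inner ?m x _"]]
    by (subst ket_inner_basis_sum)
       (use assms in \<open>auto simp: wf_qcircuit_def input_ket_basis simp del: diff_diff_left intro!: sum.cong\<close>)
  also have "\<dots> = complex_of_real (qtrace (q_qin C) (pure \<phi>))"
    unfolding qtrace_pure of_real_sum by (simp only: complex_norm_square mult.commute)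
  finally show ?thesis
    by (simp only: of_real_eq_iff)
qed

lemma sum_qprob:
  assumes "wf_qcircuit C" "length s = q_cin C" "pos_op \<rho>"
  shows "(\<Sum>z\<in>bits (q_cout C). qprob C s \<rho> z) = qtrace (q_qin C) \<rho>"
  using assms(3)
proof induction
  case (pure \<phi>)
  \<comment> \<open>Measured, output and discarded wires exhaust the circuit, so the outcome
    probabilities together sum over all basis strings.\<close>
  have m: "q_wires C = q_cout C + (q_qout C + (q_wires C - q_cout C - q_qout C))"
    using assms(1) by (simp add: wf_qcircuit_def)
  have "(\<Sum>z\<in>bits (q_cout C). qprob C s (pure \<phi>) z)
      = (\<Sum>w\<in>bits (q_wires C). (cmod (output_ket C s \<phi> w))\<^sup>2)"
    by (subst m, subst sum_bits_append, subst sum_bits_append) (simp add: qprob_pure)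
  then show ?case
    using norm_output_ket[OF assms(1,2)] by simp
qed (simp_all add: qprob_add qtrace_add sum.distrib)


section \<open>The quantum Goldreich-Levin circuit\<close>

text \<open>The adversary expects r and c right behind y, whereas the reduction receives
  \<open>vk\<close> and the register there. The exchange moves \<open>k\<close> blank wires into
  that gap, to be filled by the copy.\<close>

definition gl_prep :: "nat \<Rightarrow> nat \<Rightarrow> nat \<Rightarrow> nat \<Rightarrow> gate list \<Rightarrow> gate list" where
  "gl_prep m i p k gs = map Classical (exchange i p k) @ map H [m..<m + k]
     @ map Classical (copy_block m i k) @ gs"

text \<open>The first \<open>m\<close> wires simulate \<open>A\<close>, which may overwrite its classical input; the random string
  and the ciphertext bit are therefore kept in superposition on \<open>n + 1\<close> further wires and copied.\<close>

definition gl_circuit :: "nat \<Rightarrow> nat \<Rightarrow> nat \<Rightarrow> nat \<Rightarrow> qcircuit \<Rightarrow> qcircuit" where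
  "gl_circuit ly lv s n A = (let m = q_wires A; prep = gl_prep m ly (lv + s) (Suc n) (q_gates A) in
     \<lparr>q_cin = ly + lv, q_qin = s, q_cout = n, q_qout = 0, q_wires = m + Suc n,
      q_gates = prep @ replicate 4 (T 0) @ inverse_gates prep @ map Classical (exchange 0 m n)\<rparr>)"

lemma wf_gl_prep:
  assumes "wf_gates m gs" "i + p + k \<le> m"
  shows "wf_gates (m + k) (gl_prep m i p k gs)"
proof -
  have "wf_gates (m + k) (map H [m..<m + k])"
    by (auto simp: wf_gates_def)
  moreover have "wf_gates (m + k) (map Classical (copy_block m i k))"
    using assms by (intro wf_copy_block) auto
  ultimately show ?thesis
    using assms by (auto simp: gl_prep_def wf_exchange intro: wf_gates_mono)
qed

text \<open>\<open>gs\<close> does not touch the last \<open>k\<close> wires, so their final value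
  \<open>t\<close> singles out the branch in which \<open>gs\<close> ran on input \<open>t\<close>;
  its weight is a Hadamard entry.\<close>

lemma gl_prep_basis:
  assumes wf: "wf_gates m gs"
    and len: "length y = i" "length b = p" "length \<tau> = k" "length v = m" "length t = k"
      "i + p + k + length z = m"
  shows "apply_gates (gl_prep m i p k gs) (basis_ket (y @ b @ zeros k @ z @ \<tau>)) (v @ t)
    = ip_sign \<tau> t / complex_of_real (sqrt 2) ^ k * apply_gates gs (basis_ket (y @ t @ b @ z)) v"
proof -
  let ?v0 = "y @ zeros k @ b @ z" and ?c = "\<lambda>\<sigma>. ip_sign \<tau> \<sigma> / complex_of_real (sqrt 2) ^ k"
  let ?E = "map Classical (exchange i p k)" and ?H = "map H [m..<m + k]"
    and ?C = "map Classical (copy_block m i k)"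
  let ?e = "\<lambda>\<sigma>. y @ \<sigma> @ b @ z @ \<sigma>"
  have v0: "length ?v0 = m" using len by simp
  have E: "apply_gates ?E (basis_ket (y @ b @ zeros k @ z @ \<tau>)) w = basis_ket (?v0 @ \<tau>) w"
    if "length w = m + k" for w
    using that len
    by (subst apply_gates_Classical_basis[where m = "m + k"])
       (auto simp: wf_exchange fold_exchange')
  have H0: "apply_gates ?H (basis_ket (?v0 @ \<tau>)) w = (\<Sum>\<sigma>\<in>bits k. ?c \<sigma> * basis_ket (?v0 @ \<sigma>) w)"
    if "length w = m + k" for w
  proof -
    have "apply_gates (map H [length ?v0..<length ?v0 + length \<tau>]) (basis_ket (?v0 @ \<tau>))
        (take m w @ drop m w)
        = (\<Sum>\<sigma>\<in>bits (length \<tau>). ip_sign \<tau> \<sigma> / complex_of_real (sqrt 2) ^ length \<tau>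
            * basis_ket (?v0 @ \<sigma>) (take m w @ drop m w))"
      by (rule apply_gates_H_block_basis) (use that v0 len in auto)
    then show ?thesis
      by (simp only: v0 len(3) append_take_drop_id)
  qed
  have H: "apply_gates ?H (apply_gates ?E (basis_ket (y @ b @ zeros k @ z @ \<tau>))) w
      = (\<Sum>\<sigma>\<in>bits k. ?c \<sigma> * basis_ket (?v0 @ \<sigma>) w)" if "length w = m + k" for w
    by (subst apply_gates_cong[where m = "m + k", OF E]) (use that H0 in auto)
  have copy: "apply_gates ?C (basis_ket (?v0 @ \<sigma>)) w = basis_ket (?e \<sigma>) w"
    if "length w = m + k" "length \<sigma> = k" for w \<sigma>
  proof -
    have m: "length y + k + length (b @ z) = m" using len by simp
    have "fold apply_cgate (copy_block m i k) (?v0 @ \<sigma>) = ?e \<sigma>"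
      using fold_copy_block_right[of \<sigma> k y "b @ z" "[]"] that len unfolding m by simp
    moreover have "wf_gates (m + k) ?C"
      using len by (intro wf_copy_block) auto
    ultimately show ?thesis
      using that len by (subst apply_gates_Classical_basis[where m = "m + k"]) auto
  qed
  have C: "apply_gates ?C (apply_gates ?H (apply_gates ?E (basis_ket (y @ b @ zeros k @ z @ \<tau>)))) w
      = (\<Sum>\<sigma>\<in>bits k. ?c \<sigma> * basis_ket (?e \<sigma>) w)" if "length w = m + k" for w
  proof -
    have "apply_gates ?C (apply_gates ?H (apply_gates ?E (basis_ket (y @ b @ zeros k @ z @ \<tau>)))) w
        = apply_gates ?C (\<lambda>w. \<Sum>\<sigma>\<in>bits k. ?c \<sigma> * basis_ket (?v0 @ \<sigma>) w) w"
      using H that by (rule apply_gates_cong)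
    also have "\<dots> = (\<Sum>\<sigma>\<in>bits k. ?c \<sigma> * basis_ket (?e \<sigma>) w)"
      unfolding apply_gates_sum using copy that by (intro sum.cong refl) simp
    finally show ?thesis .
  qed
  have "apply_gates (gl_prep m i p k gs) (basis_ket (y @ b @ zeros k @ z @ \<tau>)) (v @ t)
      = (\<Sum>\<sigma>\<in>bits k. ?c \<sigma> * apply_gates gs (basis_ket ((y @ \<sigma> @ b @ z) @ \<sigma>)) (v @ t))"
  proof -
    have "apply_gates (gl_prep m i p k gs) (basis_ket (y @ b @ zeros k @ z @ \<tau>)) (v @ t)
        = apply_gates gs (\<lambda>w. \<Sum>\<sigma>\<in>bits k. ?c \<sigma> * basis_ket (?e \<sigma>) w) (v @ t)"
      unfolding gl_prep_def apply_gates_simps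
      by (rule apply_gates_cong[where m = "m + k"]) (simp_all add: C len(4,5))
    then show ?thesis
      by (simp only: apply_gates_sum append_assoc)
  qed
  \<comment> \<open>Branches whose label differs from \<open>t\<close> have amplitude zero
    here.\<close>
  also have "\<dots> = (\<Sum>\<sigma>\<in>bits k. if \<sigma> = t then ?c t * apply_gates gs (basis_ket (y @ t @ b @ z)) v else 0)"
    by (intro sum.cong refl, subst apply_gates_basis_append) (use wf len in auto)
  finally show ?thesis
    using len by simp
qed

text \<open>By unitarity \<open>prep\<close> may be applied to both sides of the overlap, which
  removes its inverse and leaves the phase flip between two prepared states. The ket is not
  normalised, whence the trace on the right.\<close>

lemma gl_bias:
  assumes wf: "wf_qcircuit A"
    and type: "has_qtype A (ly + Suc n + lv) s 1 0"
    and len: "length y = ly" "length vk = lv" "length x = n"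
  shows "((\<Sum>r\<in>bits n. qprob A (y @ r @ [ip2 x r] @ vk) (pure \<phi>) [True]
            - qprob A (y @ r @ [\<not> ip2 x r] @ vk) (pure \<phi>) [True]) / 2 ^ n)\<^sup>2
       \<le> qtrace s (pure \<phi>) * qprob (gl_circuit ly lv s n A) (y @ vk) (pure \<phi>) x"
proof -
  define m where "m = q_wires A"
  define k where "k = Suc n"
  define z where "z = zeros (m - ly - lv - s - k)"
  define N where "N = qtrace s (pure \<phi>)"
  define P where "P t = qprob A (y @ t @ vk) (pure \<phi>) [True]" for t
  define K where "K t = output_ket A (y @ t @ vk) \<phi>" for t
  define prep where "prep = gl_prep m ly (lv + s) k (q_gates A)"
  define Z where "Z = replicate 4 (T 0)"
  define e where "e \<tau> a = y @ (vk @ a) @ zeros k @ z @ \<tau>" for \<tau> a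
  define \<Psi> where "\<Psi> \<tau> = (\<lambda>w. \<Sum>a\<in>bits s. \<phi> a * basis_ket (e \<tau> a) w)" for \<tau>
  define G where "G = apply_gates (prep @ Z @ inverse_gates prep) (\<Psi> (zeros k))"
  let ?D = "\<Sum>r\<in>bits n. P (r @ [ip2 x r]) - P (r @ [\<not> ip2 x r])"
  let ?GL = "gl_circuit ly lv s n A"
  have A: "q_cin A = ly + k + lv" "q_qin A = s" "q_cout A = 1" "q_qout A = 0"
    using type by (simp_all add: has_qtype_def k_def)
  have m: "ly + k + lv + s \<le> m" "1 \<le> m"
    using wf A by (auto simp: wf_qcircuit_def m_def)
  have wfA: "wf_gates m (q_gates A)"
    using wf by (simp add: m_def wf_qcircuit_gates)
  have wfp: "wf_gates (m + k) prep"
    unfolding prep_def using wfA m by (intro wf_gl_prep) auto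
  have len_e: "length (e \<tau> a) = m + length \<tau>" if "length a = s" for \<tau> a
    using that m len by (simp add: e_def z_def)

  have prep: "apply_gates prep (\<Psi> \<tau>) (v @ t)
      = ip_sign \<tau> t / complex_of_real (sqrt 2) ^ k * K t v"
    if "length \<tau> = k" "length v = m" "length t = k" for \<tau> v t
  proof -
    have "z = zeros (q_wires A - q_cin A - q_qin A)"
      using A by (simp add: z_def m_def algebra_simps)
    then show ?thesis
      unfolding \<Psi>_def K_def output_ket_alt apply_gates_sum sum_distrib_left A prep_def e_def
      using that m len wfA
      by (intro sum.cong refl, subst gl_prep_basis) (auto simp: z_def)
  qed

  have N: "(\<Sum>v\<in>bits m. (cmod (K t v))\<^sup>2) = N" if "length t = k" for t
    using norm_output_ket[OF wf, of "y @ t @ vk" \<phi>] that len A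
    by (simp add: K_def N_def m_def)
  \<comment> \<open>Wire 0 carries the output bit, so the flip gives the weight of False minus that
    of True, and the two weights sum to \<open>N\<close>.\<close>
  have P: "(\<Sum>v\<in>bits m. (if v ! 0 then - 1 else 1) * (cmod (K t v))\<^sup>2) = N - 2 * P t"
    if "length t = k" for t
  proof -
    obtain m' where m': "m = Suc m'" using m by (cases m) auto
    have "P t = (\<Sum>v\<in>bits m'. (cmod (K t (True # v)))\<^sup>2)"
      unfolding P_def qprob_pure K_def using A m' by (simp add: m_def)
    then show ?thesis
      using N[OF that] by (simp add: m' sum_bits_Suc sum_negf)
  qed

  have amplitude: "(\<Sum>a\<in>bits s. cnj (\<phi> a) * G (e (x @ [True]) a)) = - complex_of_real (?D / 2 ^ n)"
  proof -
    let ?\<xi> = "x @ [True]"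
    have \<xi>: "length ?\<xi> = k" using len by (simp add: k_def)
    \<comment> \<open>The Hadamard normalisations of both sides of the overlap.\<close>
    have c: "cnj (complex_of_real (sqrt 2) ^ k) * complex_of_real (sqrt 2) ^ k = 2 ^ k"
      by (simp flip: of_real_mult power_mult_distrib)
    have "(\<Sum>a\<in>bits s. cnj (\<phi> a) * G (e ?\<xi> a)) = ket_inner (m + k) (\<Psi> ?\<xi>) G"
      unfolding \<Psi>_def by (rule ket_inner_basis_sum[symmetric]) (use \<xi> len_e in auto)
    also have "\<dots> = ket_inner (m + k) (apply_gates prep (\<Psi> ?\<xi>)) (apply_gates prep G)"
      by (simp add: ket_inner_apply_gates[OF wfp])
    also have "\<dots> = ket_inner (m + k) (apply_gates prep (\<Psi> ?\<xi>))
        (apply_gates Z (apply_gates prep (\<Psi> (zeros k))))"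
      unfolding G_def apply_gates_simps
      using apply_gates_inverse[of _ "inverse_gates prep"] wfp
      by (intro ket_inner_cong refl) simp
    also have "\<dots> = (\<Sum>v\<in>bits m. \<Sum>t\<in>bits k. cnj (apply_gates prep (\<Psi> ?\<xi>) (v @ t))
        * ((if v ! 0 then - 1 else 1) * apply_gates prep (\<Psi> (zeros k)) (v @ t)))"
      unfolding ket_inner_def sum_bits_append Z_def apply_gates_T4
      using m by (intro sum.cong refl) (auto simp: nth_append)
    also have "\<dots> = (\<Sum>v\<in>bits m. \<Sum>t\<in>bits k. ip_sign ?\<xi> t / 2 ^ k
        * complex_of_real ((if v ! 0 then - 1 else 1) * (cmod (K t v))\<^sup>2))"
    proof (intro sum.cong refl)
      fix v t assume vt: "v \<in> bits m" "t \<in> bits k"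
      show "cnj (apply_gates prep (\<Psi> ?\<xi>) (v @ t))
            * ((if v ! 0 then - 1 else 1) * apply_gates prep (\<Psi> (zeros k)) (v @ t))
          = ip_sign ?\<xi> t / 2 ^ k * complex_of_real ((if v ! 0 then - 1 else 1) * (cmod (K t v))\<^sup>2)"
        using vt \<xi> unfolding c[symmetric] of_real_mult complex_norm_square
        by (auto simp: prep ip_sign_def)
    qed
    also have "\<dots> = (\<Sum>t\<in>bits k. ip_sign ?\<xi> t / 2 ^ k * complex_of_real
        (\<Sum>v\<in>bits m. (if v ! 0 then - 1 else 1) * (cmod (K t v))\<^sup>2))"
      unfolding of_real_sum sum_distrib_left by (rule sum.swap)
    also have "\<dots> = (\<Sum>t\<in>bits k. ip_sign ?\<xi> t / 2 ^ k * complex_of_real (N - 2 * P t))"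
      by (intro sum.cong refl) (subst P, auto)
    \<comment> \<open>For fixed \<open>r\<close> the sign is +1 at c = x.r and -1 at the other bit:
      \<open>N\<close> cancels, and the remaining factor 2 turns \<open>2 ^ k\<close> into
      \<open>2 ^ n\<close>.\<close>
    also have "\<dots> = (\<Sum>r\<in>bits n. - (complex_of_real (P (r @ [ip2 x r]) - P (r @ [\<not> ip2 x r])) / 2 ^ n))"
      unfolding k_def sum_bits_snoc
      using len by (intro sum.cong refl) (auto simp: ip_sign_def ip2_snoc field_simps)
    also have "\<dots> = - complex_of_real (?D / 2 ^ n)"
      by (simp add: sum_negf sum_divide_distrib)
    finally show ?thesis .
  qed

  have run_in: "input_ket ?GL (y @ vk) \<phi> = \<Psi> (zeros k)"
  proof -
    have "m + k - (ly + lv) - s = k + (m - ly - lv - s - k) + k" using m by simp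
    then have "zeros (m + k - (ly + lv) - s) = zeros k @ z @ zeros k"
      unfolding z_def by (simp only: replicate_add append_assoc)
    then show ?thesis
      by (simp add: input_ket_def \<Psi>_def e_def gl_circuit_def Let_def m_def k_def
          del: diff_diff_left replicate_Suc)
  qed
  have run_out: "output_ket ?GL (y @ vk) \<phi> (x @ v @ [True]) = G (v @ x @ [True])"
    if "length v = m" for v
  proof -
    have "q_gates ?GL = (prep @ Z @ inverse_gates prep) @ map Classical (exchange 0 m n)"
      by (simp add: gl_circuit_def Let_def prep_def Z_def m_def k_def)
    then have "output_ket ?GL (y @ vk) \<phi> (x @ v @ [True])
        = G (fold apply_cgate (rev (exchange 0 m n)) (x @ v @ [True]))"
      by (simp only: output_ket_def run_in apply_gates_simps(3) apply_gates_Classical G_def)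
    also have "fold apply_cgate (rev (exchange 0 m n)) (x @ v @ [True]) = v @ x @ [True]"
      using fold_rev_exchange[of "[]" 0 v m x n "[True]"] that len by simp
    finally show ?thesis .
  qed

  have "(\<Sum>a\<in>bits s. (cmod (G (e (x @ [True]) a)))\<^sup>2)
      = (\<Sum>a\<in>bits s. (cmod (output_ket ?GL (y @ vk) \<phi> (x @ e [] a @ [True])))\<^sup>2)"
    using len_e[of _ "[]"] by (intro sum.cong refl) (simp add: run_out, simp add: e_def)
  also have "\<dots> = (\<Sum>g\<in>(\<lambda>a. e [] a @ [True]) ` bits s.
      (cmod (output_ket ?GL (y @ vk) \<phi> (x @ g)))\<^sup>2)"
    by (subst sum.reindex) (auto simp: inj_on_def e_def)
  also have "\<dots> \<le> (\<Sum>g\<in>bits (m + 1). (cmod (output_ket ?GL (y @ vk) \<phi> (x @ g)))\<^sup>2)"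
    using len_e[of _ "[]"] by (intro sum_mono2) auto
  also have "\<dots> = qprob ?GL (y @ vk) (pure \<phi>) x"
    by (simp add: qprob_pure) (simp add: gl_circuit_def Let_def m_def)
  finally have win: "(\<Sum>a\<in>bits s. (cmod (G (e (x @ [True]) a)))\<^sup>2) \<le> qprob ?GL (y @ vk) (pure \<phi>) x" .

  \<comment> \<open>Cauchy-Schwarz over the basis states of the adversary's register.\<close>
  have "\<bar>?D / 2 ^ n\<bar> = cmod (\<Sum>a\<in>bits s. cnj (\<phi> a) * G (e (x @ [True]) a))"
    unfolding amplitude norm_minus_cancel norm_of_real ..
  also have "\<dots> \<le> (\<Sum>a\<in>bits s. \<bar>cmod (\<phi> a)\<bar> * \<bar>cmod (G (e (x @ [True]) a))\<bar>)"
    by (rule sum_norm_le) (simp add: norm_mult)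
  also have "\<dots> \<le> L2_set (\<lambda>a. cmod (\<phi> a)) (bits s) * L2_set (\<lambda>a. cmod (G (e (x @ [True]) a))) (bits s)"
    by (rule L2_set_mult_ineq)
  finally have "\<bar>?D / 2 ^ n\<bar>\<^sup>2 \<le> (L2_set (\<lambda>a. cmod (\<phi> a)) (bits s)
      * L2_set (\<lambda>a. cmod (G (e (x @ [True]) a))) (bits s))\<^sup>2"
    by (rule power_mono) simp
  also have "\<dots> = N * (\<Sum>a\<in>bits s. (cmod (G (e (x @ [True]) a)))\<^sup>2)"
    by (simp add: power_mult_distrib L2_set_def N_def qtrace_pure sum_nonneg)
  also have "\<dots> \<le> N * qprob ?GL (y @ vk) (pure \<phi>) x"
    by (intro mult_left_mono win) (simp add: N_def qtrace_pure sum_nonneg)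
  finally show ?thesis
    unfolding power2_abs by (simp add: P_def N_def)
qed

text \<open>The inequality of \<open>gl_bias\<close> is quadratic; after AM-GM its right side is
  additive and its left side subadditive in \<sigma>, so it passes to sums of pure states.\<close>

lemma gl_pos_op:
  assumes wf: "wf_qcircuit A"
    and type: "has_qtype A (ly + Suc n + lv) s 1 0"
    and len: "length y = ly" "length vk = lv" "length x = n"
    and d: "0 < d" and "pos_op \<sigma>"
  shows "\<bar>(\<Sum>r\<in>bits n. qprob A (y @ r @ [ip2 x r \<noteq> \<mu>0] @ vk) \<sigma> [True]
            - qprob A (y @ r @ [ip2 x r \<noteq> \<mu>1] @ vk) \<sigma> [True]) / 2 ^ n\<bar>
       \<le> (d * qtrace s \<sigma> + qprob (gl_circuit ly lv s n A) (y @ vk) \<sigma> x / d) / 2"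
    (is "\<bar>?B \<sigma>\<bar> \<le> (d * ?N \<sigma> + ?w \<sigma> / d) / 2")
  using \<open>pos_op \<sigma>\<close>
proof induction
  case zero
  then show ?case by simp
next
  case (pure \<phi>)
  let ?B' = "(\<Sum>r\<in>bits n. qprob A (y @ r @ [ip2 x r] @ vk) (pure \<phi>) [True]
            - qprob A (y @ r @ [\<not> ip2 x r] @ vk) (pure \<phi>) [True]) / 2 ^ n"
  have amgm: "a * b \<le> ((a + b) / 2)\<^sup>2" for a b :: real
    using zero_le_power2[of "a - b"] by (simp add: power2_eq_square field_simps)
  have N: "0 \<le> ?N (pure \<phi>)" and w: "0 \<le> ?w (pure \<phi>)"
    by (auto intro: qtrace_nonneg qprob_nonneg pos_op.pure)
  \<comment> \<open>Messages (0, 1) give \<open>?B'\<close>, messages (1, 0) its negative, equal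
    messages zero.\<close>
  have sgn: "?B (pure \<phi>) = ?B' \<or> ?B (pure \<phi>) = - ?B' \<or> ?B (pure \<phi>) = 0"
    by (cases \<mu>0; cases \<mu>1) (auto simp: sum_subtractf minus_divide_left)
  have "?B'\<^sup>2 \<le> ?N (pure \<phi>) * ?w (pure \<phi>)"
    by (rule gl_bias[OF wf type len])
  moreover have "0\<^sup>2 \<le> ?N (pure \<phi>) * ?w (pure \<phi>)"
    using N w by simp
  ultimately have "(?B (pure \<phi>))\<^sup>2 \<le> ?N (pure \<phi>) * ?w (pure \<phi>)"
    using sgn by (elim disjE) (simp_all only: power2_minus)
  \<comment> \<open>Rescaling the factors by \<open>d\<close> lets AM-GM yield the weights
    wanted.\<close>
  also have "\<dots> = (d * ?N (pure \<phi>)) * (?w (pure \<phi>) / d)"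
    using d by simp
  also have "\<dots> \<le> ((d * ?N (pure \<phi>) + ?w (pure \<phi>) / d) / 2)\<^sup>2"
    by (rule amgm)
  finally have "\<bar>?B (pure \<phi>)\<bar> \<le> \<bar>(d * ?N (pure \<phi>) + ?w (pure \<phi>) / d) / 2\<bar>"
    by (simp only: abs_le_square_iff)
  moreover have "0 \<le> (d * ?N (pure \<phi>) + ?w (pure \<phi>) / d) / 2"
    using N w d by simp
  ultimately show ?case
    by (simp only: abs_of_nonneg)
next
  case (add \<rho> \<sigma>)
  have "?B (\<lambda>u v. \<rho> u v + \<sigma> u v) = ?B \<rho> + ?B \<sigma>"
    by (simp add: qprob_add sum.distrib sum_subtractf add_divide_distrib diff_divide_distrib)
  moreover have "d * ?N (\<lambda>u v. \<rho> u v + \<sigma> u v) + ?w (\<lambda>u v. \<rho> u v + \<sigma> u v) / d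
      = (d * ?N \<rho> + ?w \<rho> / d) + (d * ?N \<sigma> + ?w \<sigma> / d)"
    by (simp add: qprob_add qtrace_add algebra_simps add_divide_distrib)
  moreover have "\<bar>a + b\<bar> \<le> (u + v) / 2" if "\<bar>a\<bar> \<le> u / 2" "\<bar>b\<bar> \<le> v / 2" for a b u v :: real
    using that abs_triangle_ineq[of a b] by simp
  ultimately show ?case
    using add.IH by (simp only:)
qed

section \<open>Well-formedness and size of the Goldreich-Levin circuit\<close>

lemma wf_qcircuitI:
  assumes "q_cin C + q_qin C \<le> q_wires C" "q_cout C + q_qout C \<le> q_wires C"
    and "wf_gates (q_wires C) (q_gates C)"
  shows "wf_qcircuit C"
  using assms by (simp add: wf_qcircuit_def wf_gates_def)

lemma wf_gl_circuit:
  assumes "wf_qcircuit A" "has_qtype A (ly + Suc n + lv) s 1 0"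
  shows "wf_qcircuit (gl_circuit ly lv s n A)"
proof -
  have m: "ly + Suc n + lv + s \<le> q_wires A" "1 \<le> q_wires A"
    using assms by (auto simp: wf_qcircuit_def has_qtype_def)
  moreover have "wf_gates (q_wires A + Suc n)
      (gl_prep (q_wires A) ly (lv + s) (Suc n) (q_gates A))"
    using m assms by (intro wf_gl_prep wf_qcircuit_gates) auto
  moreover have "wf_gates (q_wires A + Suc n) (replicate 4 (T 0))"
    using m by (auto simp: wf_gates_def)
  ultimately show ?thesis
    by (intro wf_qcircuitI) (auto simp: gl_circuit_def Let_def wf_exchange)
qed

lemma has_qtype_gl_circuit: "has_qtype (gl_circuit ly lv s n A) (ly + lv) s n 0"
  by (simp add: has_qtype_def gl_circuit_def Let_def)

text \<open>The quadratic term counts the exchange in each of the two preparations (3 + 3) and the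
  final one (3); the linear term counts their Hadamard gates and copies; 4 is the phase
  flip.\<close>

lemma length_gl_circuit:
  assumes "wf_qcircuit A" "has_qtype A (ly + Suc n + lv) s 1 0"
  shows "length (q_gates (gl_circuit ly lv s n A))
    \<le> 9 * (q_wires A * q_wires A) + 4 * q_wires A + 2 * length (q_gates A) + 4"
proof -
  define m where "m = q_wires A"
  have m: "lv + s \<le> m" "Suc n \<le> m"
    using assms by (auto simp: m_def wf_qcircuit_def has_qtype_def)
  then have "(lv + s) * Suc n \<le> m * m" "m * n \<le> m * m"
    by (intro mult_le_mono; simp)+
  moreover have "length (q_gates (gl_circuit ly lv s n A))
      = 2 * (3 * ((lv + s) * Suc n) + Suc n + Suc n + length (q_gates A)) + 4 + 3 * (m * n)"
    by (simp add: gl_circuit_def Let_def gl_prep_def length_exchange m_def algebra_simps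
        del: exchange.simps)
  moreover have "2 * (3 * a + c + c + g) + 4 + 3 * b \<le> 9 * M + 4 * m + 2 * g + 4"
    if "a \<le> M" "b \<le> M" "c \<le> m" for a b c g M :: nat
    using that by arith
  ultimately show ?thesis
    using m(2) unfolding m_def[symmetric] by (simp only:)
qed


section \<open>The first stage of the reduction\<close>

text \<open>The encryption key is duplicated, since it is also the classical part of the decryption key,
  and the two messages are moved to the discarded wires.\<close>

definition dup_circuit :: "nat \<Rightarrow> nat \<Rightarrow> nat \<Rightarrow> nat \<Rightarrow> qcircuit \<Rightarrow> qcircuit" where
  "dup_circuit le lt lc s A =
     \<lparr>q_cin = le, q_qin = lt, q_cout = lc, q_qout = s, q_wires = q_wires A,
      q_gates = map Classical (exchange le lt le @ copy_block 0 le le) @ q_gates A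
        @ map Classical (exchange lc 2 s)\<rparr>"

lemma has_qtype_dup_circuit: "has_qtype (dup_circuit le lt lc s A) le lt lc s"
  by (simp add: has_qtype_def dup_circuit_def)

lemma wf_dup_circuit:
  assumes "wf_qcircuit A" "has_qtype A (le + le) lt (lc + 2) s"
  shows "wf_qcircuit (dup_circuit le lt lc s A)"
proof -
  have "wf_gates (q_wires A) (map Classical (copy_block 0 le le))"
    using assms by (intro wf_copy_block) (auto simp: wf_qcircuit_def has_qtype_def)
  then show ?thesis
    using assms wf_qcircuit_gates[of A]
    by (intro wf_qcircuitI)
       (auto simp: dup_circuit_def wf_exchange wf_qcircuit_def has_qtype_def)
qed

text \<open>The 7 is one copy per key bit plus 3 * 2 for moving two message bits past the
  register.\<close>

lemma length_dup_circuit: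
  assumes "wf_qcircuit A" "has_qtype A (le + le) lt (lc + 2) s"
  shows "length (q_gates (dup_circuit le lt lc s A))
    \<le> 3 * (q_wires A * q_wires A) + 7 * q_wires A + length (q_gates A)"
proof -
  have m: "le \<le> q_wires A" "lt \<le> q_wires A" "s \<le> q_wires A"
    using assms by (auto simp: wf_qcircuit_def has_qtype_def)
  then have "lt * le \<le> q_wires A * q_wires A"
    by (intro mult_le_mono)
  with m show ?thesis
    by (simp add: dup_circuit_def length_exchange)
qed

lemma output_dup_circuit:
  assumes wf: "wf_qcircuit A" and type: "has_qtype A (le + le) lt (lc + 2) s"
    and len: "length ek = le" "length cert = lc" "length u = s" "length \<mu> = 2"
      "length g = q_wires A - (lc + 2) - s"
  shows "output_ket (dup_circuit le lt lc s A) ek \<phi> (cert @ u @ \<mu> @ g)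
       = output_ket A (ek @ ek) \<phi> (cert @ \<mu> @ u @ g)"
proof -
  define m where "m = q_wires A"
  have A: "q_cin A = le + le" "q_qin A = lt" "q_cout A = lc + 2" "q_qout A = s"
    using type by (simp_all add: has_qtype_def)
  have m: "le + le + lt \<le> m" "lc + 2 + s \<le> m"
    using wf A by (simp_all add: wf_qcircuit_def m_def)
  let ?C = "map Classical (exchange le lt le @ copy_block 0 le le)"
  let ?z = "zeros (m - (le + le) - lt)"
  have "m - le - lt = le + (m - (le + le) - lt)" using m by simp
  then have z: "zeros (m - le - lt) = zeros le @ ?z"
    by (simp only: replicate_add)
  have wfC: "wf_gates m ?C"
    using m by (auto simp: wf_exchange intro!: wf_copy_block)
  have C: "apply_gates ?C (basis_ket (ek @ a @ zeros le @ ?z)) w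
      = basis_ket ((ek @ ek) @ a @ ?z) w"
    if "length a = lt" "length w = m" for a w
    using that len m wfC
    by (subst apply_gates_Classical_basis[where m = m])
       (auto simp: fold_exchange' fold_copy_block_left)
  have "output_ket (dup_circuit le lt lc s A) ek \<phi> (cert @ u @ \<mu> @ g)
      = apply_gates (q_gates A) (apply_gates ?C (input_ket (dup_circuit le lt lc s A) ek \<phi>))
          (fold apply_cgate (rev (exchange lc 2 s)) (cert @ u @ \<mu> @ g))"
    by (simp add: output_ket_def dup_circuit_def apply_gates_Classical)
  also have "\<dots> = apply_gates (q_gates A)
      (apply_gates ?C (input_ket (dup_circuit le lt lc s A) ek \<phi>)) (cert @ \<mu> @ u @ g)"
    using len by (subst fold_rev_exchange) auto
  also have "\<dots> = apply_gates (q_gates A) (input_ket A (ek @ ek) \<phi>) (cert @ \<mu> @ u @ g)"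
  proof (rule apply_gates_cong[where m = m])
    fix w :: "bool list" assume w: "length w = m"
    have "apply_gates ?C (input_ket (dup_circuit le lt lc s A) ek \<phi>) w
        = (\<Sum>a\<in>bits lt. \<phi> a * apply_gates ?C (basis_ket (ek @ a @ zeros le @ ?z)) w)"
      unfolding input_ket_def apply_gates_sum
      by (simp add: dup_circuit_def z m_def[symmetric] del: diff_diff_left map_append)
    also have "\<dots> = input_ket A (ek @ ek) \<phi> w"
      unfolding input_ket_def A m_def[symmetric] using w by (intro sum.cong refl) (subst C, auto)
    finally show "apply_gates ?C (input_ket (dup_circuit le lt lc s A) ek \<phi>) w
        = input_ket A (ek @ ek) \<phi> w" .
  qed (use len m in \<open>simp add: m_def\<close>)
  finally show ?thesis
    by (simp add: output_ket_def)
qed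

text \<open>The messages are the first two discarded wires, so tracing out adds up the four
  branches.\<close>

lemma qrun_dup_circuit:
  assumes wf: "wf_qcircuit A" and type: "has_qtype A (le + le) lt (lc + 2) s"
    and len: "length ek = le" "length cert = lc" "length u = s" "length v = s"
    and "pos_op \<rho>"
  shows "qrun (dup_circuit le lt lc s A) ek \<rho> cert u v
       = (\<Sum>\<mu>\<in>bits 2. qrun A (ek @ ek) \<rho> (cert @ \<mu>) u v)"
  using \<open>pos_op \<rho>\<close>
proof induction
  case (pure \<phi>)
  have "q_cout A + q_qout A \<le> q_wires A" "q_cout A = lc + 2" "q_qout A = s"
    using wf type by (auto simp: wf_qcircuit_def has_qtype_def)
  then have d: "q_wires (dup_circuit le lt lc s A) - q_cout (dup_circuit le lt lc s A)
      - q_qout (dup_circuit le lt lc s A) = 2 + (q_wires A - (lc + 2) - s)"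
    and A: "q_cout A = lc + 2" "q_qout A = s"
    by (auto simp: dup_circuit_def)
  show ?case
    unfolding qrun_pure d A sum_bits_append
    by (intro sum.cong refl) (simp add: pure_def output_dup_circuit[OF wf type len(1,2)] len)
qed (simp_all add: qrun_zero qrun_add sum.distrib)

text \<open>Lets \<open>qrun_dup_circuit\<close>, an equality at strings of the right length only,
  be used inside a probability.\<close>

lemma qprob_cong:
  assumes "\<And>u v. length u = q_qin C \<Longrightarrow> length v = q_qin C \<Longrightarrow> \<rho> u v = \<sigma> u v"
  shows "qprob C s \<rho> z = qprob C s \<sigma> z"
proof -
  have "qrun C s \<rho> z = qrun C s \<sigma> z"
    unfolding qrun_def measure_op_def by (intro ext sum.cong refl) (simp add: assms)
  then show ?thesis
    by (simp add: qprob_def)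
qed


section \<open>Asymptotics\<close>

lemma poly_bounded_mono:
  assumes "poly_bounded g" "\<And>l. f l \<le> g l"
  shows "poly_bounded f"
proof -
  obtain k where "(\<lambda>l. real (g l)) \<in> O(\<lambda>l. real l ^ k)"
    using assms(1) by (auto simp: poly_bounded_def)
  moreover have "(\<lambda>l. real (f l)) \<in> O(\<lambda>l. real (g l))"
    using assms(2) by (intro landau_o.big_mono) auto
  ultimately show ?thesis
    unfolding poly_bounded_def using landau_o.big_trans by blast
qed

lemma poly_bounded_const: "poly_bounded (\<lambda>_. c)"
  unfolding poly_bounded_def by (rule exI[of _ 0]) simp

lemma poly_bounded_add:
  assumes "poly_bounded f" "poly_bounded g"
  shows "poly_bounded (\<lambda>l. f l + g l)"
proof -
  obtain a b where ab: "(\<lambda>l. real (f l)) \<in> O(\<lambda>l. real l ^ a)" "(\<lambda>l. real (g l)) \<in> O(\<lambda>l. real l ^ b)"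
    using assms by (auto simp: poly_bounded_def)
  have *: "(\<lambda>l. real l ^ c) \<in> O(\<lambda>l. real l ^ max a b)" if "c \<le> max a b" for c
    by (intro landau_o.big_mono eventually_mono[OF eventually_ge_at_top[of 1]])
       (use that in \<open>auto intro: power_increasing\<close>)
  have "(\<lambda>l. real (f l) + real (g l)) \<in> O(\<lambda>l. real l ^ max a b)"
    by (intro sum_in_bigo landau_o.big_trans[OF ab(1)] landau_o.big_trans[OF ab(2)] *) auto
  then show ?thesis
    by (auto simp: poly_bounded_def)
qed

lemma poly_bounded_mult:
  assumes "poly_bounded f" "poly_bounded g"
  shows "poly_bounded (\<lambda>l. f l * g l)"
proof -
  obtain a b where "(\<lambda>l. real (f l)) \<in> O(\<lambda>l. real l ^ a)" "(\<lambda>l. real (g l)) \<in> O(\<lambda>l. real l ^ b)"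
    using assms by (auto simp: poly_bounded_def)
  then have "(\<lambda>l. real (f l * g l)) \<in> O(\<lambda>l. real l ^ (a + b))"
    by (simp add: power_add landau_o.big.mult)
  then show ?thesis
    by (auto simp: poly_bounded_def)
qed

lemmas poly_bounded_intros = poly_bounded_const poly_bounded_add poly_bounded_mult

lemma negligible_sqrt:
  assumes "negligible W" "\<And>l. 0 \<le> f l" "\<And>l. f l \<le> sqrt \<bar>W l\<bar>"
  shows "negligible f"
  unfolding negligible_def
proof
  fix k
  \<comment> \<open>The root halves the exponent, hence twice \<open>k\<close>.\<close>
  obtain c where c: "0 < c" "eventually (\<lambda>l. norm (W l) \<le> c * norm (1 / real l ^ (k + k))) at_top"
    using assms(1) unfolding negligible_def by (blast elim: landau_o.bigE)
  from c(2) have "eventually (\<lambda>l. norm (f l) \<le> sqrt c * norm (1 / real l ^ k)) at_top"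
  proof (rule eventually_mono)
    fix l assume "norm (W l) \<le> c * norm (1 / real l ^ (k + k))"
    then have "sqrt \<bar>W l\<bar> \<le> sqrt (c * (1 / real l ^ k)\<^sup>2)"
      by (simp add: power_add power2_eq_square)
    also have "\<dots> = sqrt c * (1 / real l ^ k)"
      using c(1) by (simp add: real_sqrt_mult real_sqrt_divide)
    finally show "norm (f l) \<le> sqrt c * norm (1 / real l ^ k)"
      using assms(2,3)[of l] by simp
  qed
  then show "f \<in> O(\<lambda>l. 1 / real l ^ k)"
    by (rule bigoI)
qed

text \<open>The infimum of the bounds is attained at d = sqrt w, except for w = 0, where d has to
  tend to 0.\<close>

lemma le_sqrt_if_balanced:
  fixes a w :: real
  assumes "0 \<le> w" "\<And>d. 0 < d \<Longrightarrow> a \<le> (d + w / d) / 2"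
  shows "a \<le> sqrt w"
proof (cases "w = 0")
  case True
  then have "a \<le> e" if "0 < e" for e
    using assms(2)[of "2 * e"] that by simp
  then show ?thesis
    using True field_le_epsilon[of a 0] by simp
next
  case False
  then show ?thesis
    using assms(2)[of "sqrt w"] assms(1) by (simp add: real_div_sqrt)
qed

section \<open>The advantage of an adversary\<close>

lemma length_crun:
  assumes "wf_ccircuit C" "length s = c_in C" "length coins = c_coins C"
  shows "length (crun C s coins) = c_out C"
  using assms by (simp add: crun_def wf_ccircuit_def)

lemma tdf_syntaxD:
  assumes "tdf_syntax S"
  shows "wf_qcircuit (TDF_KG S l)" "wf_ccircuit (TDF_Samp S l)" "wf_ccircuit (TDF_Eval S l)"
    and "has_qtype (TDF_KG S l) 0 0 (len_ek S l + len_vk S l) (len_td S l)"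
    and "has_ctype (TDF_Samp S l) (len_ek S l) (n_dom S l)"
    and "has_ctype (TDF_Eval S l) (len_ek S l + n_dom S l) (len_y S l)"
    and "c_coins (TDF_Eval S l) = 0"
  using assms by (auto simp: tdf_syntax_def QPT_def PPT_def nonuniform_QPT_def)

lemma set_tdf_samp:
  assumes "tdf_syntax S" "length ek = len_ek S l"
  shows "set_pmf (tdf_samp S l ek) \<subseteq> bits (n_dom S l)"
  using tdf_syntaxD(2,5)[OF assms(1), of l] assms(2)
  by (auto simp: tdf_samp_def csample_def set_pmf_of_set length_crun has_ctype_def)

lemma length_tdf_eval:
  assumes "tdf_syntax S" "length ek = len_ek S l" "length x = n_dom S l"
  shows "length (tdf_eval S l ek x) = len_y S l"
  using tdf_syntaxD(3,6,7)[OF assms(1), of l] assms(2,3)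
  by (auto simp: tdf_eval_def length_crun has_ctype_def)

lemma expectation_tdf_samp:
  fixes f :: "bool list \<Rightarrow> real"
  assumes "tdf_syntax S" "length ek = len_ek S l"
  shows "measure_pmf.expectation (tdf_samp S l ek) f
       = (\<Sum>x\<in>bits (n_dom S l). pmf (tdf_samp S l ek) x * f x)"
  using set_tdf_samp[OF assms] by (subst integral_measure_pmf_real[of "bits (n_dom S l)"]) (auto simp: mult.commute)

text \<open>Encryption draws r first; the sum over x is moved outside because the Goldreich-Levin
  bound averages over r for fixed x.\<close>

lemma expectation_skl_enc:
  fixes f :: "bool list \<Rightarrow> real"
  assumes "tdf_syntax S" "length ek = len_ek S l"
  shows "measure_pmf.expectation (skl_enc S l ek \<mu>) f
       = (\<Sum>x\<in>bits (n_dom S l). pmf (tdf_samp S l ek) x *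
           ((\<Sum>r\<in>bits (n_dom S l). f (tdf_eval S l ek x @ r @ [ip2 x r \<noteq> \<mu>])) / 2 ^ n_dom S l))"
proof -
  let ?B = "bits (n_dom S l)"
  have fin: "finite (set_pmf (tdf_samp S l ek))"
    using set_tdf_samp[OF assms] finite_subset finite_bits by blast
  have "measure_pmf.expectation (skl_enc S l ek \<mu>) f
      = (\<Sum>r\<in>?B. (\<Sum>x\<in>?B. pmf (tdf_samp S l ek) x * f (tdf_eval S l ek x @ r @ [ip2 x r \<noteq> \<mu>])) / 2 ^ n_dom S l)"
    unfolding skl_enc_def
    using set_tdf_samp[OF assms] fin
    by (subst pmf_expectation_bind_pmf_of_set)
       (auto simp: pmf_expectation_bind[of ?B] card_bits divide_inverse mult.commute)
  also have "\<dots> = (\<Sum>x\<in>?B. \<Sum>r\<in>?B. pmf (tdf_samp S l ek) x * f (tdf_eval S l ek x @ r @ [ip2 x r \<noteq> \<mu>]) / 2 ^ n_dom S l)"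
    unfolding sum_divide_distrib by (rule sum.swap)
  finally show ?thesis
    by (simp add: sum_divide_distrib sum_distrib_left)
qed

lemma pos_op_tdf_kg: "pos_op (tdf_kg S l ek vk)"
  unfolding tdf_kg_def by (intro pos_op_qrun pos_op_no_qubits)

lemma sum_qtrace_tdf_kg:
  assumes "tdf_syntax S"
  shows "(\<Sum>ek\<in>bits (len_ek S l). \<Sum>vk\<in>bits (len_vk S l). qtrace (len_td S l) (tdf_kg S l ek vk)) = 1"
proof -
  let ?C = "TDF_KG S l"
  have C: "wf_qcircuit ?C" "q_cin ?C = 0" "q_qin ?C = 0" "q_cout ?C = len_ek S l + len_vk S l"
    "q_qout ?C = len_td S l"
    using tdf_syntaxD(1,4)[OF assms, of l] by (auto simp: has_qtype_def)
  have "(\<Sum>z\<in>bits (q_cout ?C). qprob ?C [] no_qubits z) = qtrace (q_qin ?C) no_qubits"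
    by (rule sum_qprob) (use C pos_op_no_qubits in auto)
  then show ?thesis
    by (simp add: C sum_bits_append qprob_def tdf_kg_def) (simp add: qtrace_def no_qubits_def)
qed

text \<open>Key generation gives the zero operator unless the classical part of the decryption key
  is \<open>ek\<close>, so the sum over \<open>dkc\<close> collapses.\<close>

lemma ind_vra_exp_PKESKL:
  assumes "tdf_syntax S"
  shows "ind_vra_exp (PKESKL S) A1 A2 l b =
    (\<Sum>ek\<in>bits (len_ek S l). \<Sum>vk\<in>bits (len_vk S l).
     \<Sum>cert\<in>{cert \<in> bits (len_cert S l). tdf_vrfy S l vk cert}.
     \<Sum>x\<in>bits (n_dom S l). \<Sum>\<mu>0\<in>UNIV. \<Sum>\<mu>1\<in>UNIV. pmf (tdf_samp S l ek) x *
       ((\<Sum>r\<in>bits (n_dom S l). qprob (A2 l)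
           (tdf_eval S l ek x @ r @ [ip2 x r \<noteq> (if b then \<mu>1 else \<mu>0)] @ vk)
           (qrun (A1 l) (ek @ ek) (tdf_kg S l ek vk) (cert @ [\<mu>0, \<mu>1])) [True]) / 2 ^ n_dom S l))"
proof -
  let ?V = "\<lambda>vk. {cert \<in> bits (len_cert S l). tdf_vrfy S l vk cert}"
  let ?E = "\<lambda>ek vk cert \<mu>0 \<mu>1. measure_pmf.expectation (skl_enc S l ek (if b then \<mu>1 else \<mu>0))
      (\<lambda>ct. qprob (A2 l) (ct @ vk)
        (qrun (A1 l) (ek @ ek) (tdf_kg S l ek vk) (cert @ [\<mu>0, \<mu>1])) [True])"
  have "ind_vra_exp (PKESKL S) A1 A2 l b = (\<Sum>ek\<in>bits (len_ek S l). \<Sum>dkc\<in>bits (len_ek S l).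
      if dkc = ek then \<Sum>vk\<in>bits (len_vk S l). \<Sum>cert\<in>?V vk. \<Sum>\<mu>0\<in>UNIV. \<Sum>\<mu>1\<in>UNIV. ?E ek vk cert \<mu>0 \<mu>1
      else 0)"
    unfolding ind_vra_exp_def PKESKL_def by (intro sum.cong refl) (simp_all add: qrun_zero)
  also have "\<dots> = (\<Sum>ek\<in>bits (len_ek S l). \<Sum>vk\<in>bits (len_vk S l). \<Sum>cert\<in>?V vk. \<Sum>\<mu>0\<in>UNIV. \<Sum>\<mu>1\<in>UNIV.
      ?E ek vk cert \<mu>0 \<mu>1)"
    by (rule sum.cong[OF refl]) simp
  finally show ?thesis
    by (simp add: UNIV_bool expectation_skl_enc[OF assms] flip: sum.distrib)
qed

section \<open>The reduction and the resulting bound\<close>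

definition reduction1 :: "tdf_skl \<Rightarrow> (nat \<Rightarrow> nat) \<Rightarrow> (nat \<Rightarrow> qcircuit) \<Rightarrow> nat \<Rightarrow> qcircuit" where
  "reduction1 S s A l = dup_circuit (len_ek S l) (len_td S l) (len_cert S l) (s l) (A l)"

definition reduction2 :: "tdf_skl \<Rightarrow> (nat \<Rightarrow> nat) \<Rightarrow> (nat \<Rightarrow> qcircuit) \<Rightarrow> nat \<Rightarrow> qcircuit" where
  "reduction2 S s A l = gl_circuit (len_y S l) (len_vk S l) (s l) (n_dom S l) (A l)"

text \<open>\<open>gl_pos_op\<close> bounds each term with the same \<open>d\<close>. The traces
  then add up to at most the total mass 1 of the keys, and the probabilities of guessing x to
  exactly the winning probability.\<close>

lemma advantage_le:
  assumes syn: "tdf_syntax S"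
    and wf1: "wf_qcircuit (A1 l)"
    and type1: "has_qtype (A1 l) (len_ek S l + len_ek S l) (len_td S l) (len_cert S l + 2) (s l)"
    and wf2: "wf_qcircuit (A2 l)"
    and type2: "has_qtype (A2 l) (len_y S l + Suc (n_dom S l) + len_vk S l) (s l) 1 0"
    and d: "0 < d"
  shows "\<bar>ind_vra_exp (PKESKL S) A1 A2 l False - ind_vra_exp (PKESKL S) A1 A2 l True\<bar>
       \<le> (d + ow_vra_win S (reduction1 S s A1) (reduction2 S s A2) l / d) / 2"
proof -
  let ?EK = "bits (len_ek S l)" and ?VK = "bits (len_vk S l)" and ?X = "bits (n_dom S l)"
  let ?V = "\<lambda>vk. {cert \<in> bits (len_cert S l). tdf_vrfy S l vk cert}"
  let ?p = "\<lambda>ek. pmf (tdf_samp S l ek)"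
  define \<sigma> where "\<sigma> ek vk z = qrun (A1 l) (ek @ ek) (tdf_kg S l ek vk) z" for ek vk z
  define w where "w ek vk z x
      = qprob (reduction2 S s A2 l) (tdf_eval S l ek x @ vk) (\<sigma> ek vk z) x" for ek vk z x
  define B where "B ek vk cert x \<mu>0 \<mu>1 = (\<Sum>r\<in>?X.
      qprob (A2 l) (tdf_eval S l ek x @ r @ [ip2 x r \<noteq> \<mu>0] @ vk) (\<sigma> ek vk (cert @ [\<mu>0, \<mu>1])) [True]
    - qprob (A2 l) (tdf_eval S l ek x @ r @ [ip2 x r \<noteq> \<mu>1] @ vk) (\<sigma> ek vk (cert @ [\<mu>0, \<mu>1])) [True])
      / 2 ^ n_dom S l" for ek vk cert x \<mu>0 \<mu>1
  have pos: "pos_op (\<sigma> ek vk z)" for ek vk z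
    unfolding \<sigma>_def by (intro pos_op_qrun pos_op_tdf_kg)

  have B: "\<bar>B ek vk cert x \<mu>0 \<mu>1\<bar>
      \<le> (d * qtrace (s l) (\<sigma> ek vk (cert @ [\<mu>0, \<mu>1])) + w ek vk (cert @ [\<mu>0, \<mu>1]) x / d) / 2"
    if "ek \<in> ?EK" "vk \<in> ?VK" "x \<in> ?X" for ek vk cert x \<mu>0 \<mu>1
    unfolding B_def w_def reduction2_def
    by (rule gl_pos_op[OF wf2 type2]) (use that syn d pos length_tdf_eval in auto)

  have win: "(\<Sum>\<mu>\<in>bits 2. w ek vk (cert @ \<mu>) x) = qprob (reduction2 S s A2 l) (tdf_eval S l ek x @ vk)
      (qrun (reduction1 S s A1 l) ek (tdf_kg S l ek vk) cert) x"
    if "ek \<in> ?EK" "cert \<in> bits (len_cert S l)" for ek vk cert x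
  proof -
    have "(\<Sum>\<mu>\<in>bits 2. w ek vk (cert @ \<mu>) x) = qprob (reduction2 S s A2 l) (tdf_eval S l ek x @ vk)
        (\<lambda>u v. \<Sum>\<mu>\<in>bits 2. \<sigma> ek vk (cert @ \<mu>) u v) x"
      unfolding w_def by (rule qprob_sum[symmetric]) simp
    also have "\<dots> = qprob (reduction2 S s A2 l) (tdf_eval S l ek x @ vk)
        (qrun (reduction1 S s A1 l) ek (tdf_kg S l ek vk) cert) x"
      unfolding \<sigma>_def reduction1_def
      by (rule qprob_cong, rule qrun_dup_circuit[OF wf1 type1, symmetric])
         (use that in \<open>auto simp: reduction2_def gl_circuit_def Let_def pos_op_tdf_kg\<close>)
    finally show ?thesis .
  qed

  \<comment> \<open>Only an inequality, since rejected certificates are left out.\<close>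
  have trace: "(\<Sum>cert\<in>?V vk. \<Sum>\<mu>\<in>bits 2. qtrace (s l) (\<sigma> ek vk (cert @ \<mu>)))
      \<le> qtrace (len_td S l) (tdf_kg S l ek vk)" if "ek \<in> ?EK" for ek vk
  proof -
    have A: "q_cin (A1 l) = len_ek S l + len_ek S l" "q_qin (A1 l) = len_td S l"
      "q_cout (A1 l) = len_cert S l + 2" "q_qout (A1 l) = s l"
      using type1 by (auto simp: has_qtype_def)
    have "(\<Sum>cert\<in>?V vk. \<Sum>\<mu>\<in>bits 2. qtrace (s l) (\<sigma> ek vk (cert @ \<mu>)))
        \<le> (\<Sum>cert\<in>bits (len_cert S l). \<Sum>\<mu>\<in>bits 2. qtrace (s l) (\<sigma> ek vk (cert @ \<mu>)))"
      by (intro sum_mono2 sum_nonneg qtrace_nonneg pos) auto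
    also have "\<dots> = (\<Sum>z\<in>bits (q_cout (A1 l)). qprob (A1 l) (ek @ ek) (tdf_kg S l ek vk) z)"
      unfolding A sum_bits_append by (simp only: qprob_def \<sigma>_def A)
    also have "\<dots> = qtrace (q_qin (A1 l)) (tdf_kg S l ek vk)"
      by (rule sum_qprob) (use wf1 that A pos_op_tdf_kg in auto)
    finally show ?thesis
      by (simp only: A)
  qed

  have "\<bar>ind_vra_exp (PKESKL S) A1 A2 l False - ind_vra_exp (PKESKL S) A1 A2 l True\<bar>
      = \<bar>\<Sum>ek\<in>?EK. \<Sum>vk\<in>?VK. \<Sum>cert\<in>?V vk. \<Sum>x\<in>?X. \<Sum>\<mu>0\<in>UNIV. \<Sum>\<mu>1\<in>UNIV.
          ?p ek x * B ek vk cert x \<mu>0 \<mu>1\<bar>"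
    unfolding ind_vra_exp_PKESKL[OF syn] sum_subtractf[symmetric] B_def \<sigma>_def
    by (simp only: if_True if_False sum_subtractf diff_divide_distrib right_diff_distrib)
  also have "\<dots> \<le> (\<Sum>ek\<in>?EK. \<Sum>vk\<in>?VK. \<Sum>cert\<in>?V vk. \<Sum>x\<in>?X. \<Sum>\<mu>0\<in>UNIV. \<Sum>\<mu>1\<in>UNIV. ?p ek x *
      ((d * qtrace (s l) (\<sigma> ek vk (cert @ [\<mu>0, \<mu>1])) + w ek vk (cert @ [\<mu>0, \<mu>1]) x / d) / 2))"
    by (intro sum_abs[THEN order_trans] sum_mono) (simp only: abs_mult abs_of_nonneg[OF pmf_nonneg], intro mult_left_mono B pmf_nonneg)
  also have "\<dots> = (\<Sum>ek\<in>?EK. \<Sum>vk\<in>?VK. \<Sum>cert\<in>?V vk. \<Sum>x\<in>?X. \<Sum>\<mu>\<in>bits 2. ?p ek x *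
      ((d * qtrace (s l) (\<sigma> ek vk (cert @ \<mu>)) + w ek vk (cert @ \<mu>) x / d) / 2))"
    unfolding sum_bits_2 ..
  also have "\<dots> = d / 2 * (\<Sum>ek\<in>?EK. \<Sum>vk\<in>?VK. \<Sum>cert\<in>?V vk. \<Sum>x\<in>?X. \<Sum>\<mu>\<in>bits 2.
        ?p ek x * qtrace (s l) (\<sigma> ek vk (cert @ \<mu>)))
      + (\<Sum>ek\<in>?EK. \<Sum>vk\<in>?VK. \<Sum>cert\<in>?V vk. \<Sum>x\<in>?X. \<Sum>\<mu>\<in>bits 2. ?p ek x * w ek vk (cert @ \<mu>) x) / (2 * d)"
    unfolding sum_distrib_left sum_divide_distrib sum.distrib[symmetric]
    using d by (intro sum.cong refl) (simp add: field_simps)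
  also have "(\<Sum>ek\<in>?EK. \<Sum>vk\<in>?VK. \<Sum>cert\<in>?V vk. \<Sum>x\<in>?X. \<Sum>\<mu>\<in>bits 2. ?p ek x * w ek vk (cert @ \<mu>) x)
      = ow_vra_win S (reduction1 S s A1) (reduction2 S s A2) l"
    unfolding ow_vra_win_def
    by (intro sum.cong refl) (auto simp: expectation_tdf_samp[OF syn] win simp flip: sum_distrib_left)
  also have "(\<Sum>ek\<in>?EK. \<Sum>vk\<in>?VK. \<Sum>cert\<in>?V vk. \<Sum>x\<in>?X. \<Sum>\<mu>\<in>bits 2.
        ?p ek x * qtrace (s l) (\<sigma> ek vk (cert @ \<mu>)))
      = (\<Sum>ek\<in>?EK. \<Sum>vk\<in>?VK. \<Sum>cert\<in>?V vk. \<Sum>\<mu>\<in>bits 2. qtrace (s l) (\<sigma> ek vk (cert @ \<mu>)))"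
  \<comment> \<open>The trace does not depend on \<open>x\<close>, so the sampler's weights sum to
    1.\<close>
  proof (rule sum.cong[OF refl], rule sum.cong[OF refl], rule sum.cong[OF refl])
    fix ek vk cert assume "ek \<in> ?EK"
    then have "(\<Sum>x\<in>?X. ?p ek x) = 1"
      using set_tdf_samp[OF syn] by (intro sum_pmf_eq_1) auto
    then show "(\<Sum>x\<in>?X. \<Sum>\<mu>\<in>bits 2. ?p ek x * qtrace (s l) (\<sigma> ek vk (cert @ \<mu>)))
        = (\<Sum>\<mu>\<in>bits 2. qtrace (s l) (\<sigma> ek vk (cert @ \<mu>)))"
      by (simp flip: sum_distrib_left sum_distrib_right)
  qed
  also have "d / 2 * \<dots> \<le> d / 2 * (\<Sum>ek\<in>?EK. \<Sum>vk\<in>?VK. qtrace (len_td S l) (tdf_kg S l ek vk))"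
    using d by (intro mult_left_mono sum_mono trace) auto
  also have "\<dots> = d / 2"
    by (simp add: sum_qtrace_tdf_kg[OF syn])
  finally show ?thesis
    by (simp add: add_divide_distrib)
qed

text \<open>Each coefficient is the larger of those in \<open>length_dup_circuit\<close> and
  \<open>length_gl_circuit\<close>.\<close>

lemma nonuniform_QPT_bounds:
  assumes "nonuniform_QPT A" "\<And>l. wf_qcircuit (C l)"
    and "\<And>l. q_wires (C l) \<le> 2 * q_wires (A l)"
    and "\<And>l. length (q_gates (C l))
      \<le> 9 * (q_wires (A l) * q_wires (A l)) + 7 * q_wires (A l) + 2 * length (q_gates (A l)) + 4"
  shows "nonuniform_QPT C"
proof -
  have A: "poly_bounded (\<lambda>l. q_wires (A l))" "poly_bounded (\<lambda>l. length (q_gates (A l)))"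
    using assms(1) by (auto simp: nonuniform_QPT_def)
  have "poly_bounded (\<lambda>l. q_wires (C l))"
    using assms(3) by (rule poly_bounded_mono[rotated]) (intro poly_bounded_intros A)
  moreover have "poly_bounded (\<lambda>l. length (q_gates (C l)))"
    using assms(4) by (rule poly_bounded_mono[rotated]) (intro poly_bounded_intros A)
  ultimately show ?thesis
    using assms(2) by (simp add: nonuniform_QPT_def)
qed

theorem lemma4p17:
  fixes TDFSKL :: tdf_skl
  assumes "is_tdf_skl TDFSKL"
  shows "ind_vra_secure (PKESKL TDFSKL)"
  unfolding ind_vra_secure_def
proof (intro allI impI)
  let ?S = TDFSKL
  fix A1 A2 assume adv: "ind_vra_adversary (PKESKL ?S) A1 A2"
  have syn: "tdf_syntax ?S" and ow: "ow_vra_secure ?S"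
    using assms by (auto simp: is_tdf_skl_def)
  obtain s where
    type1: "\<And>l. has_qtype (A1 l) (len_ek ?S l + len_ek ?S l) (len_td ?S l) (len_cert ?S l + 2) (s l)" and
    type2: "\<And>l. has_qtype (A2 l) (len_y ?S l + Suc (n_dom ?S l) + len_vk ?S l) (s l) 1 0"
    using adv by (auto simp: ind_vra_adversary_def PKESKL_def)
  have A: "nonuniform_QPT A1" "nonuniform_QPT A2"
    using adv by (auto simp: ind_vra_adversary_def)
  then have wf: "wf_qcircuit (A1 l)" "wf_qcircuit (A2 l)" for l
    by (auto simp: nonuniform_QPT_def)
  let ?B1 = "reduction1 ?S s A1" and ?B2 = "reduction2 ?S s A2"
  let ?adv = "\<lambda>l. \<bar>ind_vra_exp (PKESKL ?S) A1 A2 l False - ind_vra_exp (PKESKL ?S) A1 A2 l True\<bar>"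
  have "nonuniform_QPT ?B1"
  proof (rule nonuniform_QPT_bounds[OF A(1)])
    fix l
    show "wf_qcircuit (?B1 l)"
      unfolding reduction1_def by (rule wf_dup_circuit[OF wf(1) type1])
    show "q_wires (?B1 l) \<le> 2 * q_wires (A1 l)"
      by (simp add: reduction1_def dup_circuit_def)
    show "length (q_gates (?B1 l)) \<le> 9 * (q_wires (A1 l) * q_wires (A1 l)) + 7 * q_wires (A1 l)
        + 2 * length (q_gates (A1 l)) + 4"
      using length_dup_circuit[OF wf(1) type1, of l] by (simp add: reduction1_def)
  qed
  moreover have "nonuniform_QPT ?B2"
  proof (rule nonuniform_QPT_bounds[OF A(2)])
    fix l
    show "wf_qcircuit (?B2 l)"
      unfolding reduction2_def by (rule wf_gl_circuit[OF wf(2) type2])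
    \<comment> \<open>The input of \<open>A2\<close> contains r and c, so the \<open>n + 1\<close>
      label wires at most double its size.\<close>
    show "q_wires (?B2 l) \<le> 2 * q_wires (A2 l)"
      using wf(2)[of l] type2[of l]
      by (simp add: reduction2_def gl_circuit_def Let_def wf_qcircuit_def has_qtype_def)
    show "length (q_gates (?B2 l)) \<le> 9 * (q_wires (A2 l) * q_wires (A2 l)) + 7 * q_wires (A2 l)
        + 2 * length (q_gates (A2 l)) + 4"
      using length_gl_circuit[OF wf(2) type2, of l] by (simp add: reduction2_def)
  qed
  ultimately have "ow_vra_adversary ?S ?B1 ?B2"
    unfolding ow_vra_adversary_def
    by (auto simp: reduction1_def reduction2_def has_qtype_dup_circuit has_qtype_gl_circuit
        intro!: exI[of _ s])
  then have "negligible (ow_vra_win ?S ?B1 ?B2)"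
    using ow by (simp add: ow_vra_secure_def)
  then show "negligible ?adv"
  proof (rule negligible_sqrt)
    fix l
    show "?adv l \<le> sqrt \<bar>ow_vra_win ?S ?B1 ?B2 l\<bar>"
    proof (rule le_sqrt_if_balanced)
      fix d :: real assume d: "0 < d"
      have "?adv l \<le> (d + ow_vra_win ?S ?B1 ?B2 l / d) / 2"
        by (rule advantage_le[OF syn wf(1) type1 wf(2) type2 d])
      \<comment> \<open>The absolute value supplies the sign condition of
        \<open>le_sqrt_if_balanced\<close>.\<close>
      also have "\<dots> \<le> (d + \<bar>ow_vra_win ?S ?B1 ?B2 l\<bar> / d) / 2"
        using d by (simp add: divide_right_mono)
      finally show "?adv l \<le> (d + \<bar>ow_vra_win ?S ?B1 ?B2 l\<bar> / d) / 2" .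
    qed simp
  qed simp
qed

end
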